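(* Let $X$ be a subordinator (without killing) with Laplace exponent $\phi$ such that: (S1) $\phi$ is unbounded and $X$ has zero drift; (S2) $a+\phi$ is a special Bernstein function for some $a\ge0$; (S3) there exist $\beta>0$, $\overline{\theta}\in[0,\infty)$ and $\overline{C}\in[1,\infty)$ such that $$\frac{\phi'(\eta\theta)}{\phi^2(\eta\theta)}\le\overline{C}\,\eta^{-\beta}\,\frac{\phi'(\theta)}{\phi^2(\theta)}\qquad\text{for all }\eta\ge1,\ \theta>\overline{\theta}.$$ Let $q:\mathbb{R}\to\mathbb{R}$ be Borel. Then $q\in\mathbb{K}(X)$ if and only if $$\lim_{r\to0^+}\sup_{x\in\mathbb{R}}\int_0^r|q(z+x)|\,\frac{\phi'(z^{-1})}{z^2\phi^2(z^{-1})}\,dz=0 .$$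
   Context: A subordinator is a Lévy process in $\mathbb{R}$ with non-decreasing paths; its Laplace exponent is given by $\mathbb{E}^0e^{-uX_t}=e^{-t\phi(u)}$, $u\ge0$. A Bernstein function $f$ on $(0,\infty)$ (not identically $0$) is called special if $u\mapsto u/f(u)$ is also a Bernstein function. $\mathbb{E}^x$ is the expectation for $X$ started at $x$, and $q\in\mathbb{K}(X)$ means $\lim_{t\to0^+}\sup_{x\in\mathbb{R}}\mathbb{E}^x\int_0^t|q(X_u)|\,du=0$. *)

theory Defs
  imports "HOL-Probability.Probability"
begin

text \<open>
  Time is indexed by the reals, but only the values \<open>X t\<close> with \<open>t \<ge> 0\<close> are constrained.  The
  process starts at \<open>0\<close>, so that the measure of \<open>M\<close> plays the role of the law for the starting
  point \<open>0\<close>.  Path properties hold almost surely; together with stationarity, right continuity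
  entails stochastic continuity.
\<close>

locale levy_process = prob_space M for M :: "'w measure" +
  fixes X :: "real \<Rightarrow> 'w \<Rightarrow> real"
  assumes random_variable: "\<And>t. 0 \<le> t \<Longrightarrow> X t \<in> borel_measurable M"
    and start_zero: "AE \<omega> in M. X 0 \<omega> = 0"
    and independent_increments:
      "\<And>(n::nat) (t::nat \<Rightarrow> real). 0 \<le> t 0 \<Longrightarrow> (\<And>i. i < n \<Longrightarrow> t i \<le> t (Suc i)) \<Longrightarrow>
        indep_vars (\<lambda>_. borel) (\<lambda>i \<omega>. X (t (Suc i)) \<omega> - X (t i) \<omega>) {..<n}"
    and stationary_increments:
      "\<And>s t. 0 \<le> s \<Longrightarrow> 0 \<le> t \<Longrightarrow>
        distr M borel (\<lambda>\<omega>. X (s + t) \<omega> - X s \<omega>) = distr M borel (X t)"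
    and cadlag_paths:
      "AE \<omega> in M. (\<forall>t\<ge>0. continuous (at_right t) (\<lambda>s. X s \<omega>)) \<and>
                  (\<forall>t>0. \<exists>l. ((\<lambda>s. X s \<omega>) \<longlongrightarrow> l) (at_left t))"

text \<open>There is no killing, since \<open>X t\<close> is real-valued.\<close>

locale subordinator = levy_process +
  assumes nondecreasing_paths: "AE \<omega> in M. mono_on {0..} (\<lambda>t. X t \<omega>)"

text \<open>This determines \<open>\<phi>\<close> on \<open>[0,\<infinity>)\<close>; the values on the negative half-line are irrelevant.\<close>

definition laplace_exponent ::
  "'w measure \<Rightarrow> (real \<Rightarrow> 'w \<Rightarrow> real) \<Rightarrow> (real \<Rightarrow> real) \<Rightarrow> bool" where
  "laplace_exponent M X \<phi> \<longleftrightarrow>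
    (\<forall>t\<ge>0. \<forall>u\<ge>0. (\<integral>\<omega>. exp (- u * X t \<omega>) \<partial>M) = exp (- t * \<phi> u))"

text \<open>
  The Levy-Khintchine representation \<open>\<phi>(u) = b u + \<integral> (1 - exp (-u x)) \<nu>(dx)\<close> over \<open>(0,\<infinity>)\<close>
  of the Laplace exponent of a subordinator without killing, with drift \<open>b\<close> and Levy measure
  \<open>\<nu>\<close>.  The pair \<open>(b,\<nu>)\<close> is determined by \<open>\<phi>\<close>.
\<close>

definition levy_khintchine :: "(real \<Rightarrow> real) \<Rightarrow> real \<Rightarrow> real measure \<Rightarrow> bool" where
  "levy_khintchine \<phi> b \<nu> \<longleftrightarrow>
    0 \<le> b \<and> sets \<nu> = sets borel \<and> emeasure \<nu> {..0} = 0 \<and>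
    (\<integral>\<^sup>+x. ennreal (min 1 x) \<partial>\<nu>) < \<infinity> \<and>
    (\<forall>u\<ge>0. \<phi> u = b * u + (\<integral>x. 1 - exp (- u * x) \<partial>\<nu>))"

definition has_drift :: "(real \<Rightarrow> real) \<Rightarrow> real \<Rightarrow> bool" where
  "has_drift \<phi> b \<longleftrightarrow> (\<exists>\<nu>. levy_khintchine \<phi> b \<nu>)"

text \<open>
  Functions on \<open>(0,\<infinity>)\<close> are represented by total functions; since \<open>(0,\<infinity>)\<close> is open, the
  derivatives at its points depend only on the values there.
\<close>

definition bernstein :: "(real \<Rightarrow> real) \<Rightarrow> bool" where
  "bernstein f \<longleftrightarrow>
    (\<forall>x>0. 0 \<le> f x) \<and>
    (\<forall>n. \<forall>x>0. (deriv ^^ n) f field_differentiable (at x)) \<and>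
    (\<forall>n\<ge>1. \<forall>x>0. 0 \<le> (-1) ^ (n - 1) * (deriv ^^ n) f x)"

definition special_bernstein :: "(real \<Rightarrow> real) \<Rightarrow> bool" where
  "special_bernstein f \<longleftrightarrow>
    bernstein f \<and> (\<exists>x>0. f x \<noteq> 0) \<and> bernstein (\<lambda>u. u / f u)"

text \<open>
  The process started at \<open>x\<close> is \<open>x + X\<close>.  The integrals and suprema take values in
  \<open>[0,\<infinity>]\<close>.
\<close>

definition kato_class :: "'w measure \<Rightarrow> (real \<Rightarrow> 'w \<Rightarrow> real) \<Rightarrow> (real \<Rightarrow> real) set" where
  "kato_class M X =
    {q. ((\<lambda>t. SUP x::real. \<integral>\<^sup>+\<omega>. (\<integral>\<^sup>+u\<in>{0..t}. ennreal \<bar>q (x + X u \<omega>)\<bar> \<partial>lborel) \<partial>M)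
          \<longlongrightarrow> 0) (at_right 0)}"

end

theory Submission
  imports Defs
begin

text \<open>
  Let \<open>U\<close> be the \<open>a\<close>-potential measure of \<open>X\<close>, with Laplace transform \<open>1 / (a + \<phi>)\<close>.
  Since \<open>u / (a + \<phi> u)\<close> is a Bernstein function, the integrals of the Erlang densities of rate
  \<open>s\<close> against \<open>U\<close> decrease with the shape parameter.  As \<open>s \<rightarrow> \<infinity>\<close>, Poisson concentration
  turns this into \<open>U(x + h, y + h] \<le> U(x, y]\<close>, so \<open>U\<close> has a decreasing density.  Monotonicity and
  \<open>\<integral> z exp (-s z) U(dz) = \<phi>'(s) / (a + \<phi>(s))\<^sup>2\<close> bound this density above by a multiple of
  the kernel \<open>\<phi>'(1/z) / (z\<^sup>2 \<phi>\<^sup>2(1/z))\<close>; with the scaling condition (S3) they also bound it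
  below near \<open>0\<close>.

  It remains to compare \<open>H(t) = sup\<^sub>x E \<integral>\<^sub>0\<^sup>t \<bar>q(x + X\<^sub>s)\<bar> ds\<close> with
  \<open>K(r) = sup\<^sub>x \<integral>\<^sub>[\<^sub>0\<^sub>,\<^sub>r\<^sub>) \<bar>q(x + z)\<bar> U(dz)\<close>.  Cutting time into pieces of length \<open>t\<close> gives
  \<open>K(r) \<le> H(t) \<Sum>\<^sub>k P(X\<^sub>k\<^sub>t < r)\<close>, and restarting the process when it exceeds \<open>r\<close> gives
  \<open>H(t) \<le> exp (a t) K(r) + P(X\<^sub>t \<ge> r) H(t)\<close>.
\<close>

text \<open>The rate \<open>a\<close> is the one that makes \<open>a + \<phi>\<close> special;
  discounting at that rate brings in \<open>1 / (a + \<phi>)\<close>. It does no harm to the limits: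
  on \<open>[0,t]\<close> the discount stays above \<open>exp (- a * t)\<close>, and once
  \<open>a \<le> \<phi> s\<close> the squares of \<open>a + \<phi> s\<close> and
  \<open>\<phi> s\<close> differ by a factor of at most 4. No representation of Bernstein functions
  is needed. If \<open>L\<close> is the Laplace transform of \<open>U\<close>, the derivatives of
  \<open>s * L s\<close> involve only two consecutive moments of \<open>U\<close>, so the sign
  conditions defining a Bernstein function are themselves the comparison of neighbouring Erlang
  integrals. The restart argument meets two obstacles. Restarting at a first passage time calls for
  the strong Markov property, which a time grid avoids. Absorbing \<open>H(t) / 2\<close> into the
  left side requires \<open>H(t) < \<infinity>\<close>, which is not known in advance; bounded
  functions are treated first and truncation does the rest. The order of choices differs between the
  two directions: either \<open>t\<close> is fixed and \<open>r\<close> made small, using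
  \<open>\<phi> (1 / r) \<rightarrow> \<infinity>\<close>, or \<open>r\<close> is fixed and
  \<open>t\<close> made small.\<close>

lemma power_le_fact_exp:
  fixes x :: real
  assumes "0 \<le> x"
  shows "x ^ n \<le> fact n * exp x"
proof -
  have "(\<Sum>i\<in>{n}. x ^ i /\<^sub>R fact i) \<le> (\<Sum>i. x ^ i /\<^sub>R fact i)"
    using assms by (intro sum_le_suminf summable_exp_generic) auto
  then show ?thesis by (simp add: exp_def field_simps)
qed

lemma abs_exp_minus_one_le:
  fixes x :: real
  shows "\<bar>exp x - 1\<bar> \<le> \<bar>x\<bar> * exp \<bar>x\<bar>"
proof (cases "0 \<le> x")
  case True
  have "exp x * (1 - x) \<le> exp x * exp (- x)"
    using exp_ge_add_one_self[of "- x"] by (intro mult_left_mono) auto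
  then have "exp x - 1 \<le> x * exp x"
    by (simp add: exp_minus algebra_simps)
  then show ?thesis using True by simp
next
  case False
  have "1 - exp x \<le> - x" using exp_ge_add_one_self[of x] by linarith
  also have "\<dots> * 1 \<le> - x * exp (- x)" using False by (intro mult_left_mono) auto
  finally show ?thesis using False by simp
qed

text \<open>Finiteness of \<open>H\<close> is essential: \<open>H = \<infinity>\<close> satisfies
  the inequality for every \<open>A\<close>.\<close>

lemma ennreal_le_double_self:
  fixes H A :: ennreal
  assumes "H \<le> A + ennreal (1 / 2) * H" "H < \<infinity>"
  shows "H \<le> 2 * A"
proof (cases A)
  case (real a)
  obtain h where h: "H = ennreal h" "0 \<le> h" using assms(2) by (cases H) auto
  have "ennreal (1 / 2) * H = ennreal (1 / 2 * h)" unfolding h(1) by (rule ennreal_mult'[symmetric]) simp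
  with assms(1) h real have "ennreal h \<le> ennreal (a + 1 / 2 * h)" by simp
  then have "h \<le> 2 * a" using real h by (subst (asm) ennreal_le_iff) auto
  then have "ennreal h \<le> ennreal (2 * a)" by (intro ennreal_leI)
  also have "\<dots> = 2 * ennreal a" using real by (simp add: ennreal_mult)
  finally show ?thesis using h real by simp
qed simp

lemma ennreal_tendsto_0I:
  fixes f :: "real \<Rightarrow> ennreal"
  assumes "\<And>e. 0 < e \<Longrightarrow> eventually (\<lambda>x. f x \<le> ennreal e) F"
  shows "(f \<longlongrightarrow> 0) F"
proof (rule order_tendstoI)
  fix b :: ennreal assume "0 < b"
  then obtain y where y: "0 < y" "y < b" using dense by blast
  then obtain e where "y = ennreal e" "0 < e" by (cases y) auto
  with assms[of e] y show "eventually (\<lambda>x. f x < b) F"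
    by (auto elim: eventually_mono)
qed simp

lemma ennreal_tendsto_0D:
  fixes f :: "real \<Rightarrow> ennreal"
  assumes "(f \<longlongrightarrow> 0) F" "0 < e"
  shows "eventually (\<lambda>x. f x \<le> ennreal e) F"
  using order_tendstoD(2)[OF assms(1), of "ennreal e"] assms(2) by (auto elim: eventually_mono)

text \<open>A monotone sequence crosses the level \<open>r\<close> at most once, and a crossing
  before \<open>n\<close> forces \<open>r \<le> y n\<close>. Applied to a path on a time grid, this
  bounds the total weight of all restarts by the probability of having passed \<open>r\<close> at
  the final time.\<close>

lemma sum_crossing_le:
  assumes "mono y"
  shows "(\<Sum>i<n. indicator {..<r} (y i) * indicator {r..} (y (Suc i))) \<le> (indicator {r..} (y n) :: ennreal)"
proof (induction n)
  case (Suc n)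
  show ?case
  proof (cases "r \<le> y n")
    case True
    then show ?thesis using Suc monoD[OF assms, of n "Suc n"] by auto
  next
    case False
    then show ?thesis using Suc by simp (auto split: split_indicator)
  qed
qed simp

subsection \<open>Laplace transforms and their derivatives\<close>

locale laplace_measure =
  fixes U :: "real measure"
  assumes sets_U [measurable_cong]: "sets U = sets borel"
    and AE_pos: "AE z in U. 0 < z"
    and laplace_finite: "\<And>s. 0 < s \<Longrightarrow> (\<integral>\<^sup>+z. ennreal (exp (- s * z)) \<partial>U) < \<infinity>"
begin

text \<open>Up to the sign \<open>(-1) ^ n\<close>, the \<open>n\<close>-th derivative of the
  Laplace transform of \<open>U\<close>; see \<open>has_derivative_moment\<close>.\<close>

definition moment :: "nat \<Rightarrow> real \<Rightarrow> real" where
  "moment n s = (\<integral>z. z ^ n * exp (- s * z) \<partial>U)"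

text \<open>Half of the exponential rate absorbs the power; the other half is integrable by
  assumption.\<close>

lemma integrable_moment:
  assumes "0 < s"
  shows "integrable U (\<lambda>z. z ^ n * exp (- s * z))"
proof -
  have int: "integrable U (\<lambda>z. exp (- (s / 2) * z))"
    using laplace_finite[of "s / 2"] assms by (intro integrableI_nonneg) auto
  have "AE z in U. norm (z ^ n * exp (- s * z)) \<le> norm (fact n * (2 / s) ^ n * exp (- (s / 2) * z))"
    using AE_pos
  proof eventually_elim
    case (elim z)
    have "(s / 2 * z) ^ n \<le> fact n * exp (s / 2 * z)"
      using elim assms by (intro power_le_fact_exp) auto
    then have "z ^ n \<le> fact n * (2 / s) ^ n * exp (s / 2 * z)"
      using assms by (simp add: power_mult_distrib power_divide field_simps)
    then have "z ^ n * exp (- s * z) \<le> fact n * (2 / s) ^ n * exp (s / 2 * z) * exp (- s * z)"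
      by (intro mult_right_mono) auto
    also have "\<dots> = fact n * (2 / s) ^ n * exp (- (s / 2) * z)"
      by (simp add: mult.assoc mult_exp_exp field_simps)
    finally show ?case using elim assms by simp
  qed
  then show ?thesis
    by (rule Bochner_Integration.integrable_bound[rotated 2])
       (use int in \<open>auto intro!: integrable_mult_right\<close>)
qed

lemma moment_nonneg: "0 \<le> moment n s"
  unfolding moment_def
  by (intro integral_nonneg_AE eventually_mono[OF AE_pos]) auto

lemma nn_integral_moment:
  assumes "0 < s"
  shows "(\<integral>\<^sup>+z. ennreal (z ^ n * exp (- s * z)) \<partial>U) = ennreal (moment n s)"
  unfolding moment_def
  by (intro nn_integral_eq_integral integrable_moment assms eventually_mono[OF AE_pos]) auto

text \<open>Differentiation under the integral sign, carried out along sequences so that dominated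
  convergence applies. Half of the rate is given away to dominate the difference quotients.\<close>

lemma has_derivative_moment:
  assumes s: "0 < s"
  shows "(moment n has_real_derivative - moment (Suc n) s) (at s)"
  unfolding DERIV_def tendsto_at_iff_sequentially comp_def
proof safe
  fix h :: "nat \<Rightarrow> real"
  assume h: "\<forall>i. h i \<in> UNIV - {0}" "h \<longlonglongrightarrow> 0"
  \<comment> \<open>The dominating function needs \<open>\<bar>h i\<bar> \<le> s / 2\<close> for
    every \<open>i\<close>, but this holds only eventually. The modified sequence satisfies it
    throughout, never vanishes and has the same tail.\<close>
  define h' where "h' i = (if \<bar>h i\<bar> \<le> s / 2 then h i else s / 2)" for i
  have h0: "h' i \<noteq> 0" "\<bar>h' i\<bar> \<le> s / 2" for i using h(1) s by (auto simp: h'_def)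
  have ev: "eventually (\<lambda>i. h' i = h i) sequentially"
  proof -
    have "eventually (\<lambda>i. dist (h i) 0 < s / 2) sequentially"
      using h(2) s by (intro tendstoD) auto
    then show ?thesis by eventually_elim (auto simp: h'_def)
  qed
  have h'0: "h' \<longlonglongrightarrow> 0"
    using h(2) filterlim_cong[OF refl refl ev] by blast
  have "(\<lambda>i. \<integral>z. z ^ n * exp (- s * z) * ((exp (- h' i * z) - 1) / h' i) \<partial>U)
    \<longlonglongrightarrow> (\<integral>z. z ^ n * exp (- s * z) * (- z) \<partial>U)"
  proof (rule integral_dominated_convergence)
    show "integrable U (\<lambda>z. z ^ Suc n * exp (- (s / 2) * z))"
      using s by (intro integrable_moment) auto
    show "AE z in U. (\<lambda>i. z ^ n * exp (- s * z) * ((exp (- h' i * z) - 1) / h' i))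
        \<longlonglongrightarrow> z ^ n * exp (- s * z) * (- z)"
    proof (intro AE_I2 tendsto_intros)
      fix z :: real
      have "((\<lambda>h. exp (- h * z)) has_real_derivative - z) (at 0)"
        by (auto intro!: derivative_eq_intros)
      then have "((\<lambda>h. (exp (- h * z) - 1) / h) \<longlongrightarrow> - z) (at 0)"
        by (simp add: DERIV_def)
      moreover have "filterlim h' (at 0) sequentially"
        using h'0 h0 by (auto simp: filterlim_at)
      ultimately show "(\<lambda>i. (exp (- h' i * z) - 1) / h' i) \<longlonglongrightarrow> - z"
        by (rule filterlim_compose)
    qed
    show "AE z in U. norm (z ^ n * exp (- s * z) * ((exp (- h' i * z) - 1) / h' i))
        \<le> z ^ Suc n * exp (- (s / 2) * z)" for i
      using AE_pos
    proof eventually_elim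
      case (elim z)
      have "\<bar>exp (- h' i * z) - 1\<bar> \<le> \<bar>h' i\<bar> * z * exp (\<bar>h' i\<bar> * z)"
        using abs_exp_minus_one_le[of "- h' i * z"] elim by (simp add: abs_mult)
      also have "\<dots> \<le> \<bar>h' i\<bar> * z * exp (s / 2 * z)"
        using elim h0[of i] by (intro mult_left_mono) auto
      finally have "\<bar>(exp (- h' i * z) - 1) / h' i\<bar> \<le> z * exp (s / 2 * z)"
        using h0[of i] by (simp add: field_simps)
      then have "z ^ n * exp (- s * z) * \<bar>(exp (- h' i * z) - 1) / h' i\<bar>
          \<le> z ^ n * exp (- s * z) * (z * exp (s / 2 * z))"
        using elim by (intro mult_left_mono) auto
      also have "\<dots> = z ^ Suc n * (exp (- s * z) * exp (s / 2 * z))"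
        by (simp add: mult_ac)
      also have "exp (- s * z) * exp (s / 2 * z) = exp (- (s / 2) * z)"
        by (simp add: mult_exp_exp)
      finally show ?case using elim by (simp add: abs_mult)
    qed
  qed auto
  moreover have "(\<integral>z. z ^ n * exp (- s * z) * (- z) \<partial>U) = - moment (Suc n) s"
  proof -
    have "(\<integral>z. z ^ n * exp (- s * z) * (- z) \<partial>U) = (\<integral>z. - (z ^ Suc n * exp (- s * z)) \<partial>U)"
      by (intro Bochner_Integration.integral_cong) auto
    then show ?thesis by (simp add: moment_def)
  qed
  moreover have "(\<integral>z. z ^ n * exp (- s * z) * ((exp (- h' i * z) - 1) / h' i) \<partial>U)
      = (moment n (s + h' i) - moment n s) / h' i" for i
  proof -
    have "0 < s + h' i" using s h0[of i] by linarith
    have "(\<integral>z. z ^ n * exp (- s * z) * ((exp (- h' i * z) - 1) / h' i) \<partial>U)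
        = (\<integral>z. (z ^ n * exp (- (s + h' i) * z) - z ^ n * exp (- s * z)) / h' i \<partial>U)"
      by (intro Bochner_Integration.integral_cong) (auto simp: algebra_simps exp_add exp_diff exp_minus divide_simps)
    also have "\<dots> = (moment n (s + h' i) - moment n s) / h' i"
      unfolding moment_def
      using integrable_moment[OF s, of n] integrable_moment[OF \<open>0 < s + h' i\<close>, of n]
      by (simp only: integral_divide_zero Bochner_Integration.integral_diff)
    finally show ?thesis .
  qed
  ultimately have "(\<lambda>i. (moment n (s + h' i) - moment n s) / h' i) \<longlonglongrightarrow> - moment (Suc n) s"
    by (simp only:)
  then show "(\<lambda>i. (moment n (s + h i) - moment n s) / h i) \<longlonglongrightarrow> - moment (Suc n) s"
    by (rule Lim_transform_eventually) (use ev in eventually_elim, simp)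
qed

end

subsection \<open>Monotonicity of special potential measures\<close>

definition poisson_weight :: "nat \<Rightarrow> real \<Rightarrow> real" where
  "poisson_weight n x = x ^ n / fact n * exp (- x)"

lemma poisson_weight_nonneg: "0 \<le> x \<Longrightarrow> 0 \<le> poisson_weight n x"
  by (simp add: poisson_weight_def)

lemma poisson_weight_measurable [measurable]: "poisson_weight n \<in> borel_measurable borel"
  unfolding poisson_weight_def by measurable

lemma sums_exp_real: "(\<lambda>n. x ^ n / fact n) sums exp (x::real)"
  using exp_converges[of x] by (simp add: field_simps)

text \<open>The generating function of the Poisson law with mean \<open>x\<close>. The value
  \<open>c = 1\<close> gives total mass 1, and \<open>c = exp (- 1 / s)\<close> will give an
  exponential tail bound.\<close>

lemma sums_pow_exp:
  fixes x c :: real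
  shows "(\<lambda>n. c ^ n * (x ^ n / fact n * exp (- x))) sums exp (- (x * (1 - c)))"
proof -
  have "(\<lambda>n. (c * x) ^ n / fact n * exp (- x)) sums (exp (c * x) * exp (- x))"
    by (intro sums_mult2 sums_exp_real)
  also have "exp (c * x) * exp (- x) = exp (- (x * (1 - c)))"
    by (simp add: mult_exp_exp algebra_simps)
  finally show ?thesis by (simp add: power_mult_distrib mult_ac)
qed

lemma sums_poisson_weight: "(\<lambda>n. poisson_weight n x) sums 1"
  using sums_pow_exp[of 1 x] by (simp add: poisson_weight_def)

text \<open>Variance from factorial moments: \<open>n\<^sup>2 - 2 * n * x + x\<^sup>2\<close> equals
  \<open>n * (n - 1) + (1 - 2 * x) * n + x\<^sup>2\<close>, and each factor \<open>n\<close> lowers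
  the index of \<open>x ^ n / fact n\<close> by one.\<close>

lemma sums_poisson_variance: "(\<lambda>n. (real n - x)\<^sup>2 * poisson_weight n x) sums x"
proof -
  let ?p = "\<lambda>n. x ^ n / fact n"
  have Suc: "real (Suc n) * ?p (Suc n) = x * ?p n" for n
    by (simp del: of_nat_Suc add: field_simps)
  have 0: "?p sums exp x" by (rule sums_exp_real)
  have "(\<lambda>n. real (Suc n) * ?p (Suc n)) sums (x * exp x)"
    unfolding Suc by (intro sums_mult 0)
  from sums_Suc[OF this] have 1: "(\<lambda>n. real n * ?p n) sums (x * exp x)" by simp
  have "(\<lambda>n. real (Suc n) * (real (Suc n) - 1) * ?p (Suc n)) sums (x * (x * exp x))"
  proof -
    have "real (Suc n) * (real (Suc n) - 1) * ?p (Suc n) = x * (real n * ?p n)" for n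
    proof -
      have "real (Suc n) * (real (Suc n) - 1) * ?p (Suc n) = real n * (real (Suc n) * ?p (Suc n))"
        by (simp only: of_nat_Suc add_diff_cancel_left' mult.assoc mult.left_commute mult.commute)
      then show ?thesis by (simp only: Suc mult.left_commute)
    qed
    then show ?thesis using sums_mult[OF 1, of x] by (simp only:)
  qed
  from sums_Suc[OF this] have 2: "(\<lambda>n. real n * (real n - 1) * ?p n) sums (x * (x * exp x))" by simp
  have "(\<lambda>n. (real n * (real n - 1) * ?p n + (1 - 2 * x) * (real n * ?p n) + x\<^sup>2 * ?p n) * exp (- x))
     sums ((x * (x * exp x) + (1 - 2 * x) * (x * exp x) + x\<^sup>2 * exp x) * exp (- x))"
    by (intro sums_mult2 sums_add sums_mult 0 1 2)
  also have "(x * (x * exp x) + (1 - 2 * x) * (x * exp x) + x\<^sup>2 * exp x) * exp (- x) = x"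
    by (simp add: exp_minus field_simps power2_eq_square)
  finally have "(\<lambda>n. (real n * (real n - 1) * ?p n + (1 - 2 * x) * (real n * ?p n) + x\<^sup>2 * ?p n) * exp (- x)) sums x" .
  moreover have "(real n * (real n - 1) * P + (1 - 2 * x) * (real n * P) + x\<^sup>2 * P) * E = (real n - x)\<^sup>2 * (P * E)"
    for n P E by (simp add: algebra_simps power2_eq_square)
  ultimately show ?thesis by (simp only: poisson_weight_def)
qed

text \<open>
  The Szasz--Mirakyan operator applied to an indicator: the probability that \<open>N / s \<in> A\<close> for a
  Poisson variable \<open>N\<close> with mean \<open>s z\<close>.
\<close>

definition szasz :: "real \<Rightarrow> real set \<Rightarrow> real \<Rightarrow> ennreal" where
  "szasz s A z = (\<Sum>n. ennreal (indicator A (real n / s) * poisson_weight n (s * z)))"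

lemma szasz_measurable [measurable]: "szasz s A \<in> borel_measurable borel"
  unfolding szasz_def by measurable

lemma szasz_add_Compl:
  assumes "0 < s" "0 \<le> z"
  shows "szasz s A z + szasz s (- A) z = 1"
proof -
  have nn: "0 \<le> poisson_weight n (s * z)" for n
    using assms by (intro poisson_weight_nonneg) auto
  have "szasz s A z + szasz s (- A) z = (\<Sum>n. ennreal (indicator A (real n / s) * poisson_weight n (s * z))
      + ennreal (indicator (- A) (real n / s) * poisson_weight n (s * z)))"
    unfolding szasz_def by (intro suminf_add) auto
  also have "\<dots> = (\<Sum>n. ennreal (poisson_weight n (s * z)))"
    by (intro suminf_cong) (auto split: split_indicator)
  also have "\<dots> = ennreal 1"
    by (intro suminf_ennreal_eq nn sums_poisson_weight)
  finally show ?thesis by simp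
qed

lemma szasz_le_1: "0 < s \<Longrightarrow> 0 \<le> z \<Longrightarrow> szasz s A z \<le> 1"
  using szasz_add_Compl[of s z A] by (metis le_iff_add)

text \<open>Chebyshev's inequality: for \<open>N\<close> Poisson with mean \<open>s * z\<close>, the
  variable \<open>N / s\<close> has mean \<open>z\<close> and variance \<open>z / s\<close>.\<close>

lemma szasz_tail:
  assumes "0 < s" "0 \<le> z" "0 < e" and A: "\<And>x. x \<in> A \<Longrightarrow> e \<le> \<bar>x - z\<bar>"
  shows "szasz s A z \<le> ennreal (z / e\<^sup>2 / s)"
proof -
  have nn: "0 \<le> poisson_weight n (s * z)" for n
    using assms by (intro poisson_weight_nonneg) auto
  have "indicator A (real n / s) * poisson_weight n (s * z)
      \<le> 1 / (e * s)\<^sup>2 * ((real n - s * z)\<^sup>2 * poisson_weight n (s * z))" for n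
  proof (cases "real n / s \<in> A")
    case True
    have "e * s \<le> \<bar>real n / s - z\<bar> * s"
      using A[OF True] assms by (intro mult_right_mono) auto
    also have "\<dots> = \<bar>real n - s * z\<bar>"
      using assms by (simp add: abs_mult_pos[symmetric] field_simps)
    finally have "(e * s)\<^sup>2 \<le> (real n - s * z)\<^sup>2"
      using assms by (subst power2_abs[of "real n - s * z", symmetric], intro power_mono) auto
    then have "1 \<le> 1 / (e * s)\<^sup>2 * (real n - s * z)\<^sup>2"
      using assms by (simp add: field_simps)
    from mult_right_mono[OF this nn[of n]] True show ?thesis by (simp add: mult_ac)
  next
    case False
    then show ?thesis using nn[of n] by simp
  qed
  then have "szasz s A z \<le> (\<Sum>n. ennreal (1 / (e * s)\<^sup>2 * ((real n - s * z)\<^sup>2 * poisson_weight n (s * z))))"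
    unfolding szasz_def by (intro suminf_le ennreal_leI) auto
  also have "\<dots> = ennreal (1 / (e * s)\<^sup>2 * (s * z))"
    by (intro suminf_ennreal_eq sums_mult sums_poisson_variance mult_nonneg_nonneg nn) auto
  also have "1 / (e * s)\<^sup>2 * (s * z) = z / e\<^sup>2 / s"
    using assms by (simp add: power2_eq_square field_simps)
  finally show ?thesis .
qed

text \<open>A Chernoff bound, uniform in \<open>s \<ge> 1\<close>. It supplies the dominating
  function, integrable against \<open>U\<close>, for the passage to the limit in
  \<open>s\<close>.\<close>

lemma szasz_exp_bound:
  assumes "1 \<le> s" "0 \<le> z" "A \<subseteq> {..y}"
  shows "szasz s A z \<le> ennreal (exp y * exp (- (1 / 2) * z))"
proof -
  have nn: "0 \<le> poisson_weight n (s * z)" for n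
    using assms by (intro poisson_weight_nonneg) auto
  have "indicator A (real n / s) * poisson_weight n (s * z)
      \<le> exp y * (exp (- 1 / s) ^ n * poisson_weight n (s * z))" for n
  proof (cases "real n / s \<in> A")
    case True
    have "1 \<le> exp (y - real n / s)" using True assms by auto
    also have "\<dots> = exp y * exp (- 1 / s) ^ n"
      by (simp add: exp_of_nat_mult[symmetric] mult_exp_exp)
    finally have "1 \<le> exp y * exp (- 1 / s) ^ n" .
    from mult_right_mono[OF this nn[of n]] True show ?thesis by (simp add: mult_ac)
  next
    case False
    then show ?thesis using nn[of n] by simp
  qed
  then have "szasz s A z \<le> (\<Sum>n. ennreal (exp y * (exp (- 1 / s) ^ n * poisson_weight n (s * z))))"
    unfolding szasz_def by (intro suminf_le ennreal_leI) auto
  also have "\<dots> = ennreal (exp y * exp (- (s * z * (1 - exp (- 1 / s)))))"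
    using assms unfolding poisson_weight_def
    by (intro suminf_ennreal_eq sums_mult sums_pow_exp) auto
  also have "\<dots> \<le> ennreal (exp y * exp (- (1 / 2) * z))"
  proof -
    \<comment> \<open>Here \<open>1 / (1 + 1 / s) = 1 - 1 / (s + 1)\<close>, and
      \<open>s + 1 \<le> 2 * s\<close> because \<open>1 \<le> s\<close>. This is what makes the
      decay rate \<open>1 / 2\<close> independent of \<open>s\<close>.\<close>
    have "exp (1 / s) \<ge> 1 + 1 / s" by (rule exp_ge_add_one_self)
    then have "exp (- 1 / s) \<le> 1 / (1 + 1 / s)"
      using assms by (simp add: exp_minus field_simps add_pos_pos)
    also have "\<dots> \<le> 1 - 1 / (2 * s)"
      using assms by (simp add: field_simps)
    finally have "1 / 2 \<le> s * (1 - exp (- 1 / s))"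
      using assms by (simp add: field_simps)
    from mult_right_mono[OF this assms(2)] show ?thesis
      by (intro ennreal_leI mult_left_mono) (auto simp: mult_ac)
  qed
  finally show ?thesis .
qed

text \<open>With \<open>limsup_szasz\<close>, the two halves of the portmanteau theorem for laws
  concentrating at \<open>z\<close>. Nothing is claimed at boundary points, so open sets go with the
  lower limit and closed sets with the upper one.\<close>

lemma liminf_szasz:
  assumes "open A" "z \<in> A" "0 \<le> z" and s: "filterlim s at_top sequentially"
  shows "1 \<le> liminf (\<lambda>j. szasz (s j) A z)"
proof -
  obtain e where e: "0 < e" "\<And>x. \<bar>x - z\<bar> < e \<Longrightarrow> x \<in> A"
    using assms(1,2) by (auto simp: open_dist dist_real_def)
  have "eventually (\<lambda>j. 0 < s j) sequentially"
    using s by (simp add: filterlim_at_top_dense)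
  then have "eventually (\<lambda>j. 1 - ennreal (z / e\<^sup>2 / s j) \<le> szasz (s j) A z) sequentially"
  proof eventually_elim
    case (elim j)
    have "szasz (s j) (- A) z \<le> ennreal (z / e\<^sup>2 / s j)"
      using elim e assms by (intro szasz_tail) force+
    with szasz_add_Compl[of "s j" z A] elim assms have "1 \<le> szasz (s j) A z + ennreal (z / e\<^sup>2 / s j)"
      by (metis add_left_mono)
    then show ?case by (simp add: ennreal_minus_le_iff add.commute)
  qed
  then have "liminf (\<lambda>j. 1 - ennreal (z / e\<^sup>2 / s j)) \<le> liminf (\<lambda>j. szasz (s j) A z)"
    by (rule Liminf_mono)
  moreover have "(\<lambda>j. 1 - ennreal (z / e\<^sup>2 / s j)) \<longlonglongrightarrow> 1 - ennreal 0"
    by (intro tendsto_diff_ennreal_general tendsto_ennrealI tendsto_const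
         real_tendsto_divide_at_top[OF tendsto_const s]) auto
  ultimately show ?thesis by (simp add: lim_imp_Liminf)
qed

lemma limsup_szasz:
  assumes "closed B" "A \<subseteq> B" "0 \<le> z" and s: "filterlim s at_top sequentially"
  shows "limsup (\<lambda>j. szasz (s j) A z) \<le> indicator B z"
proof (cases "z \<in> B")
  case True
  have "eventually (\<lambda>j. 0 < s j) sequentially"
    using s by (simp add: filterlim_at_top_dense)
  then have "eventually (\<lambda>j. szasz (s j) A z \<le> 1) sequentially"
    by eventually_elim (use assms in \<open>auto intro: szasz_le_1\<close>)
  then show ?thesis using True by (auto intro: Limsup_bounded)
next
  case False
  then obtain e where e: "0 < e" "\<And>x. \<bar>x - z\<bar> < e \<Longrightarrow> x \<notin> B"
    using assms(1) open_dist[of "- B"] by (auto simp: closed_def dist_real_def)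
  have "eventually (\<lambda>j. 0 < s j) sequentially"
    using s by (simp add: filterlim_at_top_dense)
  then have "eventually (\<lambda>j. szasz (s j) A z \<le> ennreal (z / e\<^sup>2 / s j)) sequentially"
  proof eventually_elim
    case (elim j)
    have "e \<le> \<bar>x - z\<bar>" if "x \<in> A" for x
      using e(2)[of x] that assms(2) by force
    then show ?case using elim e(1) assms(3) by (intro szasz_tail) auto
  qed
  then have "limsup (\<lambda>j. szasz (s j) A z) \<le> limsup (\<lambda>j. ennreal (z / e\<^sup>2 / s j))"
    by (rule Limsup_mono)
  moreover have "(\<lambda>j. ennreal (z / e\<^sup>2 / s j)) \<longlonglongrightarrow> ennreal 0"
    by (intro tendsto_ennrealI real_tendsto_divide_at_top[OF tendsto_const s])
  ultimately show ?thesis by (simp add: lim_imp_Limsup)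
qed

section \<open>Decreasing Erlang integrals and translates of intervals\<close>

locale special_laplace_measure = laplace_measure +
  assumes moment_Suc_le: "\<And>n s. 0 < s \<Longrightarrow> s * moment (Suc n) s \<le> real (Suc n) * moment n s"
begin

text \<open>Smoothing replaces \<open>U\<close> by a discrete measure on the grid of points
  \<open>n / s\<close>. Its mass at \<open>n / s\<close> is \<open>1 / s\<close> times the integral
  against \<open>U\<close> of the Erlang density of rate \<open>s\<close> and shape
  \<open>n + 1\<close>.\<close>

lemma nn_integral_szasz:
  assumes s: "0 < s"
  shows "(\<integral>\<^sup>+z. szasz s A z \<partial>U) = (\<Sum>n. indicator A (real n / s) * ennreal (s ^ n / fact n * moment n s))"
proof -
  have "(\<integral>\<^sup>+z. szasz s A z \<partial>U) = (\<Sum>n. \<integral>\<^sup>+z. ennreal (indicator A (real n / s) * poisson_weight n (s * z)) \<partial>U)"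
    unfolding szasz_def by (intro nn_integral_suminf) measurable
  also have "\<dots> = (\<Sum>n. indicator A (real n / s) * ennreal (s ^ n / fact n * moment n s))"
  proof (intro suminf_cong)
    fix n
    show "(\<integral>\<^sup>+z. ennreal (indicator A (real n / s) * poisson_weight n (s * z)) \<partial>U)
     = indicator A (real n / s) * ennreal (s ^ n / fact n * moment n s)"
    proof -
      have "(\<integral>\<^sup>+z. ennreal (indicator A (real n / s) * poisson_weight n (s * z)) \<partial>U)
        = (\<integral>\<^sup>+z. ennreal (indicator A (real n / s) * (s ^ n / fact n)) * ennreal (z ^ n * exp (- s * z)) \<partial>U)"
        using s by (intro nn_integral_cong, subst ennreal_mult'[symmetric])
          (simp_all add: poisson_weight_def power_mult_distrib mult_ac)
      also have "\<dots> = ennreal (indicator A (real n / s) * (s ^ n / fact n)) * ennreal (moment n s)"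
        using s by (subst nn_integral_cmult) (simp_all only: nn_integral_moment, measurable)
      finally show ?thesis
        using s by (cases "real n / s \<in> A") (auto simp: ennreal_mult'[symmetric])
    qed
  qed
  finally show ?thesis .
qed

lemma scaled_moment_antimono:
  assumes s: "0 < s" and "m \<le> n"
  shows "s ^ n / fact n * moment n s \<le> s ^ m / fact m * moment m s"
  using \<open>m \<le> n\<close>
proof (induction rule: dec_induct)
  case (step k)
  have "s ^ Suc k / fact (Suc k) * moment (Suc k) s = s ^ k / fact (Suc k) * (s * moment (Suc k) s)"
    by simp
  also have "\<dots> \<le> s ^ k / fact (Suc k) * (real (Suc k) * moment k s)"
    using s by (intro mult_left_mono moment_Suc_le) auto
  also have "\<dots> = s ^ k / fact k * moment k s"
    by (simp del: of_nat_Suc add: field_simps)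
  finally show ?case using step.IH by linarith
qed simp

text \<open>On the grid the masses decrease from left to right, so a translation by \<open>j\<close>
  grid steps can only lose mass. Since \<open>A\<close> lies in \<open>[0,\<infinity>)\<close>, the
  first \<open>j\<close> grid points miss the translated set.\<close>

lemma nn_integral_szasz_shift:
  assumes "0 < s" "h = real j / s" "A \<subseteq> {0..}"
  shows "(\<integral>\<^sup>+z. szasz s ((+) h ` A) z \<partial>U) \<le> (\<integral>\<^sup>+z. szasz s A z \<partial>U)"
proof -
  let ?f = "\<lambda>n. indicator ((+) h ` A) (real n / s) * ennreal (s ^ n / fact n * moment n s)"
  have "(\<Sum>n. ?f n) = (\<Sum>n. ?f (n + j)) + (\<Sum>n<j. ?f n)"
    by (rule suminf_offset) auto
  also have "(\<Sum>n<j. ?f n) = 0"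
  proof (intro sum.neutral ballI)
    fix n assume "n \<in> {..<j}"
    then have "real n / s < h" using assms by (auto simp: divide_strict_right_mono)
    moreover have "h \<le> w" if "w \<in> (+) h ` A" for w using that assms by auto
    ultimately have "real n / s \<notin> (+) h ` A" by fastforce
    then show "?f n = 0" by simp
  qed
  also have "(\<Sum>n. ?f (n + j)) \<le> (\<Sum>n. indicator A (real n / s) * ennreal (s ^ n / fact n * moment n s))"
  proof (intro suminf_le mult_mono)
    show "indicator ((+) h ` A) (real (n + j) / s) \<le> (indicator A (real n / s) :: ennreal)" for n
      using assms by (auto simp: add_divide_distrib indicator_def)
    show "ennreal (s ^ (n + j) / fact (n + j) * moment (n + j) s) \<le> ennreal (s ^ n / fact n * moment n s)" for n
      using assms by (intro ennreal_leI scaled_moment_antimono) auto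
  qed auto
  finally show ?thesis using assms by (simp add: nn_integral_szasz)
qed

text \<open>Fatou's lemma on the left and reverse Fatou on the right of the discrete inequality.
  This is why an open interval is compared with a closed one.\<close>

lemma emeasure_open_shift_le:
  assumes "0 < h" "0 \<le> x"
  shows "emeasure U {x + h<..<y + h} \<le> emeasure U {x..y}"
proof -
  \<comment> \<open>With these rates \<open>h\<close> is exactly \<open>j + 1\<close> grid steps, so
    that the shift respects every grid.\<close>
  define s where "s j = real (Suc j) / h" for j
  have s_pos: "0 < s j" for j using assms by (simp add: s_def)
  have s: "filterlim s at_top sequentially"
  proof -
    have "filterlim (\<lambda>j. real (Suc j)) at_top sequentially"
      using filterlim_real_sequentially filterlim_sequentially_Suc by blast
    then show ?thesis
      unfolding s_def divide_inverse mult.commute[of _ "inverse h"]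
      using assms by (intro filterlim_tendsto_pos_mult_at_top[OF tendsto_const]) auto
  qed
  let ?A = "{x<..<y}"
  have img: "(+) h ` ?A = {x + h<..<y + h}"
  proof safe
    fix z assume "z \<in> {x + h<..<y + h}"
    then show "z \<in> (+) h ` {x<..<y}" by (intro image_eqI[of _ _ "z - h"]) auto
  qed auto
  \<comment> \<open>Dropping the first \<open>j0\<close> rates keeps all of them at least 1, as the
    exponential domination requires.\<close>
  obtain j0 where j0: "\<And>j. j0 \<le> j \<Longrightarrow> 1 \<le> s j"
    using s unfolding filterlim_at_top eventually_sequentially by blast
  have "emeasure U {x + h<..<y + h} = (\<integral>\<^sup>+z. indicator {x + h<..<y + h} z \<partial>U)"
    by simp
  also have "\<dots> \<le> (\<integral>\<^sup>+z. liminf (\<lambda>j. szasz (s (j + j0)) {x + h<..<y + h} z) \<partial>U)"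
  proof (intro nn_integral_mono_AE eventually_mono[OF AE_pos])
    fix z :: real assume "0 < z"
    then show "indicator {x + h<..<y + h} z \<le> liminf (\<lambda>j. szasz (s (j + j0)) {x + h<..<y + h} z)"
      using filterlim_compose[OF s, of "\<lambda>j. j + j0" sequentially]
      by (auto intro!: liminf_szasz simp: filterlim_add_const_nat_at_top split: split_indicator)
  qed
  also have "\<dots> \<le> liminf (\<lambda>j. \<integral>\<^sup>+z. szasz (s (j + j0)) {x + h<..<y + h} z \<partial>U)"
    by (intro nn_integral_liminf) auto
  also have "\<dots> \<le> liminf (\<lambda>j. \<integral>\<^sup>+z. szasz (s (j + j0)) ?A z \<partial>U)"
    unfolding img[symmetric]
  proof (intro Liminf_mono always_eventually allI)
    fix j
    have h_eq: "h = real (Suc (j + j0)) / s (j + j0)"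
      using assms by (simp del: of_nat_Suc add: s_def)
    show "(\<integral>\<^sup>+z. szasz (s (j + j0)) ((+) h ` ?A) z \<partial>U) \<le> (\<integral>\<^sup>+z. szasz (s (j + j0)) ?A z \<partial>U)"
      using assms(2) by (intro nn_integral_szasz_shift[OF s_pos h_eq]) auto
  qed
  also have "\<dots> \<le> limsup (\<lambda>j. \<integral>\<^sup>+z. szasz (s (j + j0)) ?A z \<partial>U)"
    by (intro Liminf_le_Limsup) auto
  also have "\<dots> \<le> (\<integral>\<^sup>+z. limsup (\<lambda>j. szasz (s (j + j0)) ?A z) \<partial>U)"
  proof (rule nn_integral_limsup)
    show "AE z in U. szasz (s (j + j0)) ?A z \<le> ennreal (exp y) * ennreal (exp (- (1 / 2) * z))" for j
      using AE_pos
    proof eventually_elim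
      case (elim z)
      then have "szasz (s (j + j0)) ?A z \<le> ennreal (exp y * exp (- (1 / 2) * z))"
        by (intro szasz_exp_bound j0) auto
      then show ?case by (simp only: ennreal_mult'[OF exp_ge_zero])
    qed
    show "(\<integral>\<^sup>+z. ennreal (exp y) * ennreal (exp (- (1 / 2) * z)) \<partial>U) < \<infinity>"
      using laplace_finite[of "1 / 2"] by (subst nn_integral_cmult) (auto simp: ennreal_mult_less_top)
  qed auto
  also have "\<dots> \<le> (\<integral>\<^sup>+z. indicator {x..y} z \<partial>U)"
    using filterlim_compose[OF s, of "\<lambda>j. j + j0" sequentially]
    by (intro nn_integral_mono_AE eventually_mono[OF AE_pos] limsup_szasz)
       (auto simp: filterlim_add_const_nat_at_top)
  also have "\<dots> = emeasure U {x..y}" by simp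
  finally show ?thesis .
qed

text \<open>Exhaustion from the left by \<open>A k\<close>. With
  \<open>e = 1 / real (Suc k)\<close>, the margin \<open>2 * e\<close> is spent twice: one
  \<open>e\<close> moves the left endpoint inside \<open>{x<..y}\<close>, the other enlarges the
  shift so that the open interval still contains \<open>y + h\<close>. The larger shift is also
  positive when \<open>h = 0\<close>.\<close>

lemma emeasure_Ioc_shift_le:
  assumes "0 \<le> h" "0 \<le> x"
  shows "emeasure U {x + h<..y + h} \<le> emeasure U {x<..y}"
proof -
  define A where "A k = {x + h + 2 / real (Suc k)<..y + h}" for k
  have "(\<Union>k. A k) = {x + h<..y + h}"
  proof safe
    fix z assume "z \<in> {x + h<..y + h}"
    moreover obtain k where "inverse (real (Suc k)) < (z - (x + h)) / 2"
      using calculation reals_Archimedean[of "(z - (x + h)) / 2"] by auto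
    ultimately show "z \<in> (\<Union>k. A k)" by (auto simp: A_def field_simps)
  next
    fix k z assume "z \<in> A k"
    then have z: "x + h + 2 / real (Suc k) < z" "z \<le> y + h" by (auto simp: A_def)
    have "0 < 2 / real (Suc k)" by simp
    with z have "x + h < z" by linarith
    with z show "z \<in> {x + h<..y + h}" by simp
  qed
  moreover have "incseq A"
    unfolding incseq_def
  proof (intro allI impI)
    fix k l :: nat assume "k \<le> l"
    then have "2 / real (Suc l) \<le> 2 / real (Suc k)" by (intro divide_left_mono) auto
    then show "A k \<subseteq> A l" by (auto simp: A_def)
  qed
  ultimately have "emeasure U {x + h<..y + h} = (SUP k. emeasure U (A k))"
    by (subst SUP_emeasure_incseq) (auto simp: A_def)
  also have "\<dots> \<le> emeasure U {x<..y}"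
  proof (intro SUP_least)
    fix k
    define e where "e = 1 / real (Suc k)"
    have e: "0 < e" by (simp add: e_def)
    have "e + e = 2 / real (Suc k)" by (simp add: e_def)
    then have "(x + e) + (h + e) = x + h + 2 / real (Suc k)" by linarith
    then have "A k \<subseteq> {(x + e) + (h + e)<..<y + (h + e)}"
      using e by (auto simp: A_def)
    then have "emeasure U (A k) \<le> emeasure U {(x + e) + (h + e)<..<y + (h + e)}"
      by (intro emeasure_mono) auto
    also have "\<dots> \<le> emeasure U {x + e..y}"
      using e assms by (intro emeasure_open_shift_le) auto
    also have "\<dots> \<le> emeasure U {x<..y}" using e by (intro emeasure_mono) auto
    finally show "emeasure U (A k) \<le> emeasure U {x<..y}" .
  qed
  finally show ?thesis .
qed

end

section \<open>Sign conditions from Bernstein functions; difference quotients of the measure\<close>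

context laplace_measure
begin

text \<open>Leibniz's rule for the product of \<open>s\<close> with the Laplace transform: only the
  derivatives of order 0 and 1 of the factor \<open>s\<close> survive. For \<open>n = 0\<close> the
  truncated index \<open>n - 1\<close> is harmless because of the factor
  \<open>real n\<close>.\<close>

lemma higher_deriv_mult_moment_0:
  assumes f: "\<And>s. 0 < s \<Longrightarrow> f s = s * moment 0 s" and "0 < s"
  shows "(deriv ^^ n) f s = (-1) ^ n * (s * moment n s - real n * moment (n - 1) s)"
  using \<open>0 < s\<close>
proof (induction n arbitrary: s)
  case 0
  then show ?case by (simp add: f)
next
  case (Suc n)
  let ?g = "\<lambda>s. (-1) ^ n * (s * moment n s - real n * moment (n - 1) s)"
  have "((deriv ^^ n) f has_real_derivative (-1) ^ n * (moment n s - s * moment (Suc n) s + real n * moment n s)) (at s)"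
  proof (rule has_field_derivative_transform_within_open)
    show "(?g has_real_derivative (-1) ^ n * (moment n s - s * moment (Suc n) s + real n * moment n s)) (at s)"
      using has_derivative_moment[OF Suc.prems, of n] has_derivative_moment[OF Suc.prems, of "n - 1"]
      by (cases n) (auto intro!: derivative_eq_intros simp: algebra_simps)
    show "open {0::real<..}" "s \<in> {0<..}" using Suc.prems by auto
    show "?g x = (deriv ^^ n) f x" if "x \<in> {0<..}" for x
      using Suc.IH[of x] that by simp
  qed
  from DERIV_imp_deriv[OF this] show ?case by (simp add: algebra_simps)
qed

text \<open>The sign of the derivative of order \<open>n + 1\<close> of \<open>f\<close> is the
  required inequality between the moments of orders \<open>n + 1\<close> and
  \<open>n\<close>.\<close>

lemma special_laplace_measureI:
  assumes "bernstein f" and f: "\<And>s. 0 < s \<Longrightarrow> f s = s * moment 0 s"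
  shows "special_laplace_measure U"
proof
  fix n and s :: real assume s: "0 < s"
  have "0 \<le> (-1) ^ (Suc n - 1) * (deriv ^^ Suc n) f s"
  proof -
    have *: "\<forall>n\<ge>1. \<forall>x>0. 0 \<le> (-1) ^ (n - 1) * (deriv ^^ n) f x"
      using assms(1) unfolding bernstein_def by blast
    show ?thesis by (rule *[rule_format]) (use s in auto)
  qed
  also have "\<dots> = - (s * moment (Suc n) s - real (Suc n) * moment n s)"
    by (subst higher_deriv_mult_moment_0[OF f s], assumption, cases "even n") auto
  finally show "s * moment (Suc n) s \<le> real (Suc n) * moment n s" by simp
qed

lemma emeasure_atMost_finite: "emeasure U {..y} < \<infinity>"
proof -
  have "emeasure U {..y} = (\<integral>\<^sup>+z. indicator {..y} z \<partial>U)" by simp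
  also have "\<dots> \<le> (\<integral>\<^sup>+z. ennreal (exp y) * ennreal (exp (- 1 * z)) \<partial>U)"
    by (intro nn_integral_mono)
       (auto simp: ennreal_mult'[symmetric] mult_exp_exp split: split_indicator simp del: ennreal_1 simp: ennreal_1[symmetric])
  also have "\<dots> < \<infinity>"
    using laplace_finite[of 1] by (subst nn_integral_cmult) (auto simp: ennreal_mult_less_top)
  finally show ?thesis .
qed

lemma emeasure_bounded_finite: "A \<subseteq> {..y} \<Longrightarrow> A \<in> sets borel \<Longrightarrow> emeasure U A < \<infinity>"
  using emeasure_mono[of A "{..y}" U] emeasure_atMost_finite[of y] by (simp add: le_less_trans sets_U)

sublocale sigma_finite_measure U
proof
  show "\<exists>A. countable A \<and> A \<subseteq> sets U \<and> \<Union> A = space U \<and> (\<forall>a\<in>A. emeasure U a \<noteq> \<infinity>)"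
  proof (intro exI[of _ "range (\<lambda>n::nat. {..real n})"] conjI ballI)
    show "\<Union> (range (\<lambda>n::nat. {..real n})) = space U"
      using sets_eq_imp_space_eq[OF sets_U] by (auto simp: real_arch_simple)
  qed (use emeasure_atMost_finite in \<open>auto simp: less_top[symmetric]\<close>)
qed

text \<open>Both sides measure, under Lebesgue measure times \<open>U\<close>, the strip of pairs
  \<open>(z, u)\<close> with \<open>x < z \<le> y\<close> and \<open>z < u \<le> z + h\<close>; on
  the right the variable is \<open>w = u - z\<close>. An integral of difference quotients thereby
  becomes an average of translates of \<open>{x<..y}\<close>.\<close>

lemma nn_integral_emeasure_Ioc:
  "(\<integral>\<^sup>+z\<in>{x<..y}. emeasure U {z<..z + h} \<partial>lborel) = (\<integral>\<^sup>+w\<in>{0<..h}. emeasure U {x + w<..y + w} \<partial>lborel)"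
proof -
  interpret P: pair_sigma_finite lborel U ..
  have "(\<integral>\<^sup>+z\<in>{x<..y}. emeasure U {z<..z + h} \<partial>lborel)
      = (\<integral>\<^sup>+z. \<integral>\<^sup>+u. indicator {x<..y} z * indicator {z<..z + h} u \<partial>U \<partial>lborel)"
    by (intro nn_integral_cong, subst nn_integral_cmult) (auto simp: mult_ac)
  also have "\<dots> = (\<integral>\<^sup>+u. \<integral>\<^sup>+z. indicator {x<..y} z * indicator {z<..z + h} u \<partial>lborel \<partial>U)"
    by (intro P.Fubini'[symmetric]) (simp add: indicator_def split_beta')
  also have "\<dots> = (\<integral>\<^sup>+u. \<integral>\<^sup>+w. indicator {x<..y} (u + -1 * w) * indicator {u + -1 * w<..u + -1 * w + h} u \<partial>lborel \<partial>U)"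
  proof (rule nn_integral_cong)
    fix u
    have "(\<lambda>z. indicator {x<..y} z * indicator {z<..z + h} u :: ennreal) \<in> borel_measurable borel"
      by (simp add: indicator_def)
    from nn_integral_real_affine[OF this, of "-1" u]
    show "(\<integral>\<^sup>+z. indicator {x<..y} z * indicator {z<..z + h} u \<partial>lborel)
      = (\<integral>\<^sup>+w. indicator {x<..y} (u + -1 * w) * indicator {u + -1 * w<..u + -1 * w + h} u \<partial>lborel)"
      by simp
  qed
  also have "\<dots> = (\<integral>\<^sup>+u. \<integral>\<^sup>+w. indicator {0<..h} w * indicator {x + w<..y + w} u \<partial>lborel \<partial>U)"
    by (intro nn_integral_cong) (auto split: split_indicator)
  also have "\<dots> = (\<integral>\<^sup>+w. \<integral>\<^sup>+u. indicator {0<..h} w * indicator {x + w<..y + w} u \<partial>U \<partial>lborel)"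
    by (intro P.Fubini') (simp add: indicator_def split_beta')
  also have "\<dots> = (\<integral>\<^sup>+w\<in>{0<..h}. emeasure U {x + w<..y + w} \<partial>lborel)"
    by (intro nn_integral_cong, subst nn_integral_cmult) (auto simp: mult_ac)
  finally show ?thesis .
qed

text \<open>
  If \<open>U(z, z + h]\<close> decreases in \<open>z\<close>, the averages below increase in \<open>k\<close>, so that monotone
  convergence identifies their supremum as a density.
\<close>

definition potential_density :: "real \<Rightarrow> ennreal" where
  "potential_density z = (SUP k. 2 ^ k * emeasure U {z<..z + (1 / 2) ^ k})"

lemma emeasure_Ioc_measurable [measurable]: "(\<lambda>z. emeasure U {z<..z + h}) \<in> borel_measurable borel"
proof -
  have "(\<lambda>z. \<integral>\<^sup>+u. indicator {z<..z + h} u \<partial>U) \<in> borel_measurable borel"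
    unfolding indicator_def greaterThanAtMost_iff by measurable
  then show ?thesis by simp
qed

lemma potential_density_measurable [measurable]: "potential_density \<in> borel_measurable borel"
  unfolding potential_density_def by measurable

end

context special_laplace_measure
begin

lemma potential_density_antimono:
  assumes "0 \<le> y" "y \<le> z"
  shows "potential_density z \<le> potential_density y"
  unfolding potential_density_def
proof (intro SUP_subset_mono mult_left_mono)
  fix k
  show "emeasure U {z<..z + (1 / 2) ^ k} \<le> emeasure U {y<..y + (1 / 2) ^ k}"
    using emeasure_Ioc_shift_le[of "z - y" y "y + (1 / 2) ^ k"] assms by (simp add: algebra_simps)
qed auto

text \<open>The right half is a translate of the left half. Dyadic lengths are chosen so that this
  alone makes the difference quotients monotone in \<open>k\<close>.\<close>

lemma emeasure_Ioc_double_le: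
  assumes "0 \<le> z" "0 \<le> h"
  shows "emeasure U {z<..z + 2 * h} \<le> 2 * emeasure U {z<..z + h}"
proof -
  have "{z<..z + 2 * h} = {z<..z + h} \<union> {z + h<..(z + h) + h}" using assms by auto
  then have "emeasure U {z<..z + 2 * h} \<le> emeasure U {z<..z + h} + emeasure U {z + h<..(z + h) + h}"
    by (simp add: emeasure_subadditive)
  also have "\<dots> \<le> emeasure U {z<..z + h} + emeasure U {z<..z + h}"
    using assms by (intro add_left_mono emeasure_Ioc_shift_le) auto
  finally show ?thesis by (simp only: mult_2)
qed

text \<open>The \<open>k\<close>-th integral is the average of the masses of the translates of
  \<open>{x<..y}\<close> by \<open>w \<le> (1 / 2) ^ k\<close>. Each mass is at most that of
  \<open>{x<..y}\<close> by shift monotonicity, and at least that of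
  \<open>{x + (1 / 2) ^ k<..y}\<close>, which every translate contains; both bounds meet in the
  limit.\<close>

lemma nn_integral_potential_density_Ioc:
  assumes "0 \<le> x"
  shows "(\<integral>\<^sup>+z\<in>{x<..y}. potential_density z \<partial>lborel) = emeasure U {x<..y}"
proof -
  let ?h = "\<lambda>k::nat. (1 / 2) ^ k :: real"
  let ?f = "\<lambda>k z. 2 ^ k * emeasure U {z<..z + ?h k} * indicator {x<..y} z"
  have inv: "2 ^ k * (ennreal (?h k) * a) = a" for k a
  proof -
    have "2 ^ k * ennreal (?h k) = ennreal (2 ^ k * ?h k)"
      by (simp add: ennreal_mult' ennreal_power[symmetric])
    also have "2 ^ k * ?h k = 1" by (simp add: power_mult_distrib[symmetric])
    finally show ?thesis by (simp add: mult.assoc[symmetric])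
  qed
  have eq: "(\<integral>\<^sup>+z. ?f k z \<partial>lborel) = 2 ^ k * (\<integral>\<^sup>+w\<in>{0<..?h k}. emeasure U {x + w<..y + w} \<partial>lborel)" for k
    by (simp add: nn_integral_emeasure_Ioc[symmetric] mult.assoc nn_integral_cmult)
  have le: "(\<integral>\<^sup>+z. ?f k z \<partial>lborel) \<le> emeasure U {x<..y}" for k
  proof -
    have "(\<integral>\<^sup>+w\<in>{0<..?h k}. emeasure U {x + w<..y + w} \<partial>lborel) \<le> (\<integral>\<^sup>+w\<in>{0<..?h k}. emeasure U {x<..y} \<partial>lborel)"
      using assms by (intro nn_integral_mono) (auto split: split_indicator intro: emeasure_Ioc_shift_le)
    also have "\<dots> = ennreal (?h k) * emeasure U {x<..y}"
      by (subst nn_integral_cmult_indicator) (auto simp: mult.commute)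
    finally show ?thesis unfolding eq by (metis inv mult_left_mono zero_le)
  qed
  have ge: "emeasure U {x + ?h k<..y} \<le> (\<integral>\<^sup>+z. ?f k z \<partial>lborel)" for k
  proof -
    have "ennreal (?h k) * emeasure U {x + ?h k<..y} = (\<integral>\<^sup>+w\<in>{0<..?h k}. emeasure U {x + ?h k<..y} \<partial>lborel)"
      by (subst nn_integral_cmult_indicator) (auto simp: mult.commute)
    also have "\<dots> \<le> (\<integral>\<^sup>+w\<in>{0<..?h k}. emeasure U {x + w<..y + w} \<partial>lborel)"
      by (intro nn_integral_mono) (auto split: split_indicator intro: emeasure_mono)
    finally show ?thesis unfolding eq by (metis inv mult_left_mono zero_le)
  qed
  have "(\<integral>\<^sup>+z\<in>{x<..y}. potential_density z \<partial>lborel) = (\<integral>\<^sup>+z. (SUP k. ?f k z) \<partial>lborel)"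
    unfolding potential_density_def by (intro nn_integral_cong) (simp add: SUP_mult_right_ennreal)
  also have "\<dots> = (SUP k. \<integral>\<^sup>+z. ?f k z \<partial>lborel)"
  proof (rule nn_integral_monotone_convergence_SUP)
    show "incseq ?f"
    proof (intro incseq_SucI le_funI)
      fix k z
      have "2 ^ k * emeasure U {z<..z + ?h k} \<le> 2 ^ k * (2 * emeasure U {z<..z + ?h (Suc k)})" if "x < z"
        using emeasure_Ioc_double_le[of z "?h (Suc k)"] assms that by (intro mult_left_mono) auto
      then show "?f k z \<le> ?f (Suc k) z" by (auto split: split_indicator simp: mult_ac)
    qed
  qed auto
  also have "\<dots> = emeasure U {x<..y}"
  proof (rule antisym)
    show "(SUP k. \<integral>\<^sup>+z. ?f k z \<partial>lborel) \<le> emeasure U {x<..y}" by (intro SUP_least le)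
    have "(\<Union>k. {x + ?h k<..y}) = {x<..y}"
    proof safe
      fix z assume z: "z \<in> {x<..y}"
      then obtain k where "?h k < z - x" using real_arch_pow_inv[of "z - x" "1 / 2"] by auto
      with z show "z \<in> (\<Union>k. {x + ?h k<..y})" by (auto intro!: exI[of _ k])
    next
      fix z k assume z: "z \<in> {x + ?h k<..y}"
      have "0 < ?h k" by simp
      with z have "x < z" "z \<le> y" by (auto simp del: zero_less_power)
      then show "z \<in> {x<..y}" by simp
    qed
    moreover have "incseq (\<lambda>k. {x + ?h k<..y})"
    proof (intro incseq_SucI)
      fix k
      have "x + ?h (Suc k) \<le> x + ?h k" by simp
      then show "{x + ?h k<..y} \<subseteq> {x + ?h (Suc k)<..y}"
        by (meson greaterThanAtMost_iff order.strict_trans1 subsetI)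
    qed
    ultimately have "emeasure U {x<..y} = (SUP k. emeasure U {x + ?h k<..y})"
      by (subst SUP_emeasure_incseq) auto
    also have "\<dots> \<le> (SUP k. \<integral>\<^sup>+z. ?f k z \<partial>lborel)" by (intro SUP_subset_mono ge) auto
    finally show "emeasure U {x<..y} \<le> (SUP k. \<integral>\<^sup>+z. ?f k z \<partial>lborel)" .
  qed
  finally show ?thesis .
qed

lemma density_potential_density: "density lborel (\<lambda>z. indicator {0<..} z * potential_density z) = U"
proof (rule measure_eqI_generator_eq[where E="range (\<lambda>(a, b). {a<..b})" and \<Omega>=UNIV and A="\<lambda>n. {- real n<..real n}"])
  show "Int_stable (range (\<lambda>(a, b). {a<..b::real}))"
    by (auto simp: Int_stable_def)
  have Ioc: "emeasure (density lborel (\<lambda>z. indicator {0<..} z * potential_density z)) {a<..b} = emeasure U {a<..b}" for a b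
  proof -
    have "emeasure (density lborel (\<lambda>z. indicator {0<..} z * potential_density z)) {a<..b}
        = (\<integral>\<^sup>+z\<in>{max 0 a<..b}. potential_density z \<partial>lborel)"
      by (subst emeasure_density) (auto intro!: nn_integral_cong split: split_indicator)
    also have "\<dots> = emeasure U {max 0 a<..b}" by (rule nn_integral_potential_density_Ioc) auto
    also have "\<dots> = emeasure U {a<..b}"
      by (intro emeasure_eq_AE eventually_mono[OF AE_pos]) auto
    finally show ?thesis .
  qed
  show "emeasure (density lborel (\<lambda>z. indicator {0<..} z * potential_density z)) X = emeasure U X"
    if "X \<in> range (\<lambda>(a, b). {a<..b})" for X using that Ioc by auto
  show "emeasure (density lborel (\<lambda>z. indicator {0<..} z * potential_density z)) {- real n<..real n} \<noteq> \<infinity>" for n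
  proof -
    have "emeasure U {- real n<..real n} < \<infinity>"
      by (rule emeasure_bounded_finite[of _ "real n"]) auto
    then show ?thesis unfolding Ioc by simp
  qed
  show "(\<Union>n. {- real n<..real n}) = UNIV"
  proof safe
    fix x :: real
    obtain n where "\<bar>x\<bar> < real n" using reals_Archimedean2 by blast
    then show "x \<in> (\<Union>n. {- real n<..real n})" by (auto intro!: exI[of _ n])
  qed auto
qed (auto simp: sets_U borel_sigma_sets_Ioc)

lemma nn_integral_potential_density:
  assumes [measurable]: "f \<in> borel_measurable borel"
  shows "(\<integral>\<^sup>+z. f z \<partial>U) = (\<integral>\<^sup>+z\<in>{0<..}. potential_density z * f z \<partial>lborel)"
proof -
  have "(\<integral>\<^sup>+z. f z \<partial>U) = (\<integral>\<^sup>+z. f z \<partial>density lborel (\<lambda>z. indicator {0<..} z * potential_density z))"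
    by (simp only: density_potential_density)
  also have "\<dots> = (\<integral>\<^sup>+z\<in>{0<..}. potential_density z * f z \<partial>lborel)"
    by (subst nn_integral_density) (auto intro!: nn_integral_cong simp: mult_ac)
  finally show ?thesis .
qed

lemma moment_1_eq:
  assumes "0 < s"
  shows "ennreal (moment 1 s) = (\<integral>\<^sup>+z\<in>{0<..}. potential_density z * ennreal (z * exp (- s * z)) \<partial>lborel)"
  using nn_integral_moment[OF assms, of 1]
    nn_integral_potential_density[of "\<lambda>z. ennreal (z * exp (- s * z))"] by simp

text \<open>On \<open>(0,z]\<close> the density is at least its value at \<open>z\<close> and
  \<open>exp (- u / z)\<close> is at least \<open>exp (-1)\<close>. So the first moment at rate
  \<open>1 / z\<close> is at least that value times \<open>exp (-1) * z\<^sup>2 / 2\<close>.\<close>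

lemma potential_density_le:
  assumes z: "0 < z"
  shows "potential_density z \<le> ennreal (2 * exp 1 / z\<^sup>2 * moment 1 (inverse z))"
proof -
  have "(\<integral>\<^sup>+u. ennreal (exp (-1) * u) * indicator {0..z} u \<partial>lborel) = ennreal (exp (-1) * z\<^sup>2 / 2 - exp (-1) * 0\<^sup>2 / 2)"
    using z by (intro nn_integral_FTC_Icc) (auto intro!: derivative_eq_intros)
  then have "potential_density z * ennreal (exp (-1) * z\<^sup>2 / 2)
      = (\<integral>\<^sup>+u. potential_density z * (ennreal (exp (-1) * u) * indicator {0..z} u) \<partial>lborel)"
    by (subst nn_integral_cmult) auto
  also have "\<dots> \<le> (\<integral>\<^sup>+u\<in>{0<..}. potential_density u * ennreal (u * exp (- inverse z * u)) \<partial>lborel)"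
  proof (intro nn_integral_mono)
    fix u :: real
    have "potential_density z * ennreal (exp (-1) * u) \<le> potential_density u * ennreal (u * exp (- inverse z * u))"
      if "0 < u" "u \<le> z"
    proof (intro mult_mono potential_density_antimono)
      have "u * exp (-1) \<le> u * exp (- inverse z * u)"
        using that by (intro mult_left_mono) (auto simp: field_simps)
      then show "ennreal (exp (-1) * u) \<le> ennreal (u * exp (- inverse z * u))"
        by (intro ennreal_leI) (simp add: mult.commute)
    qed (use that in auto)
    then show "potential_density z * (ennreal (exp (-1) * u) * indicator {0..z} u)
      \<le> potential_density u * ennreal (u * exp (- inverse z * u)) * indicator {0<..} u"
      by (auto simp: split: split_indicator)
  qed
  also have "\<dots> = ennreal (moment 1 (inverse z))"
    using z by (subst moment_1_eq) auto
  finally have "potential_density z * ennreal (exp (-1) * z\<^sup>2 / 2) * ennreal (2 * exp 1 / z\<^sup>2)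
      \<le> ennreal (moment 1 (inverse z)) * ennreal (2 * exp 1 / z\<^sup>2)"
    by (rule mult_right_mono) auto
  moreover have "ennreal (exp (-1) * z\<^sup>2 / 2) * ennreal (2 * exp 1 / z\<^sup>2) = 1"
    using z by (subst ennreal_mult[symmetric]) (auto simp: exp_minus field_simps)
  moreover have "ennreal (moment 1 (inverse z)) * ennreal (2 * exp 1 / z\<^sup>2) = ennreal (2 * exp 1 / z\<^sup>2 * moment 1 (inverse z))"
    by (subst ennreal_mult[symmetric]) (auto simp: moment_nonneg mult_ac)
  ultimately show ?thesis by (simp add: mult.assoc)
qed

text \<open>The moment is split at \<open>d / s\<close>. To the left
  \<open>s / d * z \<le> 1\<close>, so raising the rate to \<open>s / d\<close> costs at most a
  factor \<open>exp 1\<close>. To the right the density is at most its value at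
  \<open>d / s\<close>, and \<open>z * exp (- s * z)\<close> has total integral
  \<open>1 / s\<^sup>2\<close>.\<close>

lemma moment_1_le:
  assumes s: "0 < s" and d: "0 < d" "d \<le> 1"
  shows "ennreal (moment 1 s) \<le> ennreal (exp 1 * moment 1 (s / d)) + potential_density (d / s) * ennreal (1 / s\<^sup>2)"
proof -
  let ?v = "\<lambda>z. potential_density z * ennreal (z * exp (- s * z))"
  have "ennreal (moment 1 s) = (\<integral>\<^sup>+z\<in>{0<..}. ?v z \<partial>lborel)"
    using s by (rule moment_1_eq)
  also have "\<dots> \<le> (\<integral>\<^sup>+z. ennreal (exp 1) * (potential_density z * ennreal (z * exp (- (s / d) * z)) * indicator {0<..} z)
      + potential_density (d / s) * (ennreal (z * exp (- s * z)) * indicator {0..} z) \<partial>lborel)"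
  proof (intro nn_integral_mono)
    fix z :: real
    show "?v z * indicator {0<..} z \<le> ennreal (exp 1) * (potential_density z * ennreal (z * exp (- (s / d) * z)) * indicator {0<..} z)
      + potential_density (d / s) * (ennreal (z * exp (- s * z)) * indicator {0..} z)"
    proof (cases "0 < z \<and> z < d / s")
      case True
      have "s / d * z \<le> 1" using True s d by (simp add: field_simps)
      moreover have "0 \<le> s * z" using True s by simp
      ultimately have "- s * z \<le> 1 - s / d * z" by linarith
      then have "z * exp (- s * z) \<le> z * (exp 1 * exp (- (s / d) * z))"
        using True by (intro mult_left_mono) (auto simp: mult_exp_exp)
      then have "?v z \<le> potential_density z * ennreal (exp 1 * (z * exp (- (s / d) * z)))"
        by (intro mult_left_mono ennreal_leI) (auto simp: mult_ac)
      also have "\<dots> = ennreal (exp 1) * (potential_density z * ennreal (z * exp (- (s / d) * z)))"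
        unfolding ennreal_mult'[OF exp_ge_zero] by (rule mult.left_commute)
      finally show ?thesis using True by (auto simp: add_increasing2)
    next
      case False
      then have "0 < z \<Longrightarrow> ?v z \<le> potential_density (d / s) * ennreal (z * exp (- s * z))"
        using s d by (intro mult_right_mono potential_density_antimono) auto
      then show ?thesis by (auto split: split_indicator intro: add_increasing)
    qed
  qed
  also have "\<dots> = ennreal (exp 1) * ennreal (moment 1 (s / d))
      + potential_density (d / s) * (\<integral>\<^sup>+z. ennreal (z * exp (- s * z)) * indicator {0..} z \<partial>lborel)"
    using s d
    by (subst nn_integral_add, simp, simp, subst nn_integral_cmult, simp, subst nn_integral_cmult, simp,
        subst moment_1_eq[of "s / d"]) auto
  also have "(\<integral>\<^sup>+z. ennreal (z * exp (- s * z)) * indicator {0..} z \<partial>lborel) = ennreal (1 / s\<^sup>2)"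
  proof -
    \<comment> \<open>The index 1 denotes shape 2 here, with density
      \<open>s\<^sup>2 * z * exp (- s * z)\<close>.\<close>
    interpret E: prob_space "density lborel (erlang_density 1 s)"
      by (rule prob_space_erlang_density[OF s])
    have "(\<integral>\<^sup>+z. ennreal (z * exp (- s * z)) * indicator {0..} z \<partial>lborel)
        = (\<integral>\<^sup>+z. ennreal (1 / s\<^sup>2) * ennreal (erlang_density 1 s z) \<partial>lborel)"
      using s by (intro nn_integral_cong) (auto simp: erlang_density_def ennreal_mult'[symmetric] power2_eq_square split: split_indicator)
    also have "\<dots> = ennreal (1 / s\<^sup>2) * emeasure (density lborel (erlang_density 1 s)) UNIV"
      by (subst nn_integral_cmult) (auto simp: emeasure_density)
    finally show ?thesis using E.emeasure_space_1 by simp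
  qed
  finally show ?thesis using moment_nonneg by (simp add: ennreal_mult)
qed

end

subsection \<open>The Markov property and regular paths\<close>

context levy_process
begin

text \<open>The dummy second component is there because \<open>indep_var\<close> needs both variables of one type.\<close>

lemma independent_increment:
  assumes s: "0 \<le> s" "s \<le> s'" "0 \<le> w"
  shows "indep_var (borel \<Otimes>\<^sub>M borel) (\<lambda>\<omega>. (X s \<omega> - X 0 \<omega>, X s' \<omega> - X 0 \<omega>))
    (borel \<Otimes>\<^sub>M borel) (\<lambda>\<omega>. (X (s' + w) \<omega> - X s' \<omega>, 0 :: real))"
proof -
  define \<tau> :: "nat \<Rightarrow> real" where "\<tau> i = [0, s, s', s' + w] ! i" for i
  define D where "D i \<omega> = X (\<tau> (Suc i)) \<omega> - X (\<tau> i) \<omega>" for i \<omega>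
  have "\<tau> i \<le> \<tau> (Suc i)" if "i < 3" for i
    using that s by (auto simp: \<tau>_def less_Suc_eq numeral_3_eq_3)
  then have "indep_vars (\<lambda>_. borel) D {..<3}"
    unfolding D_def by (intro independent_increments) (auto simp: \<tau>_def)
  then have "indep_var (PiM {0, 1} (\<lambda>_. borel)) (\<lambda>\<omega>. restrict (\<lambda>i. D i \<omega>) {0, 1})
      (PiM {2} (\<lambda>_. borel)) (\<lambda>\<omega>. restrict (\<lambda>i. D i \<omega>) {2})"
    by (rule indep_var_restrict) auto
  then have "indep_var (borel \<Otimes>\<^sub>M borel) ((\<lambda>p. (p 0, p 0 + p 1)) \<circ> (\<lambda>\<omega>. restrict (\<lambda>i. D i \<omega>) {0, 1}))
      (borel \<Otimes>\<^sub>M borel) ((\<lambda>p. (p 2, 0)) \<circ> (\<lambda>\<omega>. restrict (\<lambda>i. D i \<omega>) {2}))"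
    by (rule indep_var_compose) measurable
  then show ?thesis
    by (simp add: comp_def D_def \<tau>_def numeral_2_eq_2)
qed

text \<open>The weight \<open>c\<close> sees two times because it will be the indicator of a
  crossing, which depends on both ends of a grid cell. The pair of past values is independent of the
  next increment, so their joint law is a product and the increment may be replaced by a copy of
  \<open>X w\<close> on a second sample space.\<close>

lemma nn_integral_markov:
  assumes s: "0 \<le> s" "s \<le> s'" "0 \<le> w"
    and [measurable]: "c \<in> borel_measurable (borel \<Otimes>\<^sub>M borel)" "f \<in> borel_measurable borel"
  shows "(\<integral>\<^sup>+\<omega>. c (X s \<omega>, X s' \<omega>) * f (X (s' + w) \<omega>) \<partial>M)
    = (\<integral>\<^sup>+\<omega>. c (X s \<omega>, X s' \<omega>) * (\<integral>\<^sup>+\<omega>'. f (X s' \<omega> + X w \<omega>') \<partial>M) \<partial>M)"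
proof -
  have [measurable]: "X s \<in> borel_measurable M" "X s' \<in> borel_measurable M" "X w \<in> borel_measurable M"
     "X (s' + w) \<in> borel_measurable M" "X 0 \<in> borel_measurable M"
    using s by (auto intro!: random_variable)
  let ?B = "borel \<Otimes>\<^sub>M borel :: (real \<times> real) measure"
  let ?P = "\<lambda>\<omega>. (X s \<omega> - X 0 \<omega>, X s' \<omega> - X 0 \<omega>)"
    and ?D = "\<lambda>\<omega>. (X (s' + w) \<omega> - X s' \<omega>, 0 :: real)" and ?W = "\<lambda>\<omega>. (X w \<omega>, 0 :: real)"
  let ?g = "\<lambda>(p, d). c p * f (snd p + fst d)"
  have prod: "distr M ?B ?P \<Otimes>\<^sub>M distr M ?B ?D = distr M (?B \<Otimes>\<^sub>M ?B) (\<lambda>\<omega>. (?P \<omega>, ?D \<omega>))"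
    using independent_increment[OF s] by (simp add: indep_var_distribution_eq)
  have "distr M ?B ?D = distr (distr M borel (\<lambda>\<omega>. X (s' + w) \<omega> - X s' \<omega>)) ?B (\<lambda>d. (d, 0))"
    by (subst distr_distr) (auto simp: comp_def)
  also have "\<dots> = distr (distr M borel (X w)) ?B (\<lambda>d. (d, 0))"
    using s by (subst stationary_increments) auto
  also have "\<dots> = distr M ?B ?W"
    by (subst distr_distr) (auto simp: comp_def)
  finally have dist: "distr M ?B ?D = distr M ?B ?W" .
  interpret W: prob_space "distr M ?B ?W"
    by (intro prob_space_distr) measurable
  have "(\<integral>\<^sup>+\<omega>. c (X s \<omega>, X s' \<omega>) * f (X (s' + w) \<omega>) \<partial>M) = (\<integral>\<^sup>+\<omega>. ?g (?P \<omega>, ?D \<omega>) \<partial>M)"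
    by (intro nn_integral_cong_AE eventually_mono[OF start_zero]) auto
  also have "\<dots> = (\<integral>\<^sup>+y. ?g y \<partial>distr M (?B \<Otimes>\<^sub>M ?B) (\<lambda>\<omega>. (?P \<omega>, ?D \<omega>)))"
    by (subst nn_integral_distr) auto
  also have "\<dots> = (\<integral>\<^sup>+p. \<integral>\<^sup>+d. ?g (p, d) \<partial>distr M ?B ?W \<partial>distr M ?B ?P)"
    unfolding prod[symmetric] dist
    by (subst W.nn_integral_fst[symmetric]) auto
  also have "\<dots> = (\<integral>\<^sup>+p. \<integral>\<^sup>+\<omega>'. ?g (p, ?W \<omega>') \<partial>M \<partial>distr M ?B ?P)"
    by (intro nn_integral_cong, subst nn_integral_distr) auto
  also have "\<dots> = (\<integral>\<^sup>+\<omega>. \<integral>\<^sup>+\<omega>'. ?g (?P \<omega>, ?W \<omega>') \<partial>M \<partial>M)"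
    by (subst nn_integral_distr) auto
  also have "\<dots> = (\<integral>\<^sup>+\<omega>. c (X s \<omega>, X s' \<omega>) * (\<integral>\<^sup>+\<omega>'. f (X s' \<omega> + X w \<omega>') \<partial>M) \<partial>M)"
    by (intro nn_integral_cong_AE eventually_mono[OF start_zero])
       (auto simp: nn_integral_cmult[symmetric])
  finally show ?thesis .
qed

end

section \<open>A version all of whose paths are regular\<close>

locale regular_subordinator = prob_space M for M :: "'w measure" +
  fixes Y :: "real \<Rightarrow> 'w \<Rightarrow> real" and \<phi> :: "real \<Rightarrow> real"
  assumes measurable_Y [measurable]: "\<And>t. Y t \<in> borel_measurable M"
    and Y_nonpos: "\<And>t \<omega>. t \<le> 0 \<Longrightarrow> Y t \<omega> = 0"
    and Y_mono: "\<And>s t \<omega>. s \<le> t \<Longrightarrow> Y s \<omega> \<le> Y t \<omega>"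
    and Y_right_continuous: "\<And>t \<omega>. continuous (at_right t) (\<lambda>s. Y s \<omega>)"
    and Y_markov: "\<And>s s' w c f. \<lbrakk>0 \<le> s; s \<le> s'; 0 \<le> w; c \<in> borel_measurable (borel \<Otimes>\<^sub>M borel);
        f \<in> borel_measurable borel\<rbrakk> \<Longrightarrow>
      (\<integral>\<^sup>+\<omega>. c (Y s \<omega>, Y s' \<omega>) * f (Y (s' + w) \<omega>) \<partial>M)
        = (\<integral>\<^sup>+\<omega>. c (Y s \<omega>, Y s' \<omega>) * (\<integral>\<^sup>+\<omega>'. f (Y s' \<omega> + Y w \<omega>') \<partial>M) \<partial>M)"
    and Y_laplace: "\<And>t u. 0 \<le> t \<Longrightarrow> 0 \<le> u \<Longrightarrow>
      (\<integral>\<^sup>+\<omega>. ennreal (exp (- u * Y t \<omega>)) \<partial>M) = ennreal (exp (- t * \<phi> u))"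

text \<open>On the single null set of bad paths the process is replaced by the zero path, and
  negative times are sent to 0. The path conditions then hold for every sample point and on the
  whole time axis, which frees the later arguments from exceptional sets; laws at fixed times are
  unchanged.\<close>

lemma (in subordinator) regular_modification:
  assumes lap: "laplace_exponent M X \<phi>"
  shows "\<exists>Y. regular_subordinator M Y \<phi> \<and> (AE \<omega> in M. \<forall>t\<ge>0. Y t \<omega> = X t \<omega>)"
proof -
  have "AE \<omega> in M. X 0 \<omega> = 0 \<and> (\<forall>t\<ge>0. continuous (at_right t) (\<lambda>s. X s \<omega>)) \<and> mono_on {0..} (\<lambda>t. X t \<omega>)"
    using start_zero cadlag_paths nondecreasing_paths by eventually_elim auto
  then obtain N where N: "N \<in> null_sets M"
    "\<And>\<omega>. \<omega> \<in> space M - N \<Longrightarrow> X 0 \<omega> = 0"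
    "\<And>\<omega> t. \<omega> \<in> space M - N \<Longrightarrow> 0 \<le> t \<Longrightarrow> continuous (at_right t) (\<lambda>s. X s \<omega>)"
    "\<And>\<omega>. \<omega> \<in> space M - N \<Longrightarrow> mono_on {0..} (\<lambda>t. X t \<omega>)"
    by (elim AE_E3) blast
  define Y where "Y t \<omega> = (if \<omega> \<in> space M - N then X (max 0 t) \<omega> else 0)" for t \<omega>
  have AE_eq: "AE \<omega> in M. \<forall>t\<ge>0. Y t \<omega> = X t \<omega>"
    using AE_not_in[OF N(1)] AE_space by eventually_elim (auto simp: Y_def max_def)
  have N_sets [measurable]: "N \<in> sets M" using N(1) by auto
  have Y_mono: "Y s \<omega> \<le> Y t \<omega>" if "s \<le> t" for s t \<omega>
    using N(4)[of \<omega>] that by (auto simp: Y_def intro: mono_onD)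
  have Y_nonneg: "0 \<le> Y t \<omega>" for t \<omega>
    using Y_mono[of 0 "max 0 t" \<omega>] N(2)[of \<omega>] by (auto simp: Y_def)
  have Y_X: "AE \<omega> in M. Y t \<omega> = X t \<omega>" if "0 \<le> t" for t
    using AE_eq by eventually_elim (use that in auto)
  have [measurable]: "Y t \<in> borel_measurable M" for t
  proof -
    have [measurable]: "X (max 0 t) \<in> borel_measurable M" by (intro random_variable) auto
    show ?thesis unfolding Y_def by measurable
  qed
  have "regular_subordinator M Y \<phi>"
  proof
    show "Y t \<omega> = 0" if "t \<le> 0" for t \<omega>
      using that N(2)[of \<omega>] by (auto simp: Y_def)
    show "continuous (at_right t) (\<lambda>s. Y s \<omega>)" for t \<omega>
    proof (cases "\<omega> \<in> space M - N")
      case True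
      have "((\<lambda>s. X (max 0 s) \<omega>) \<longlongrightarrow> X (max 0 t) \<omega>) (at_right t)"
      proof (cases "0 \<le> t")
        case True
        have "((\<lambda>s. X s \<omega>) \<longlongrightarrow> X t \<omega>) (at_right t)"
          using N(3)[OF \<open>\<omega> \<in> space M - N\<close> True] by (simp add: continuous_within)
        moreover have "eventually (\<lambda>s. X s \<omega> = X (max 0 s) \<omega>) (at_right t)"
          using True by (auto simp: eventually_at_filter max_def)
        ultimately show ?thesis
          using True by (auto simp: max_absorb2 intro: Lim_transform_eventually)
      next
        case False
        then have "eventually (\<lambda>s. s < 0) (at_right t)"
          by (intro eventually_at_rightI[of t 0]) auto
        then have "eventually (\<lambda>s. X (max 0 t) \<omega> = X (max 0 s) \<omega>) (at_right t)"
          by eventually_elim (use False in \<open>auto simp: max_def\<close>)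
        then show ?thesis by (rule Lim_transform_eventually[OF tendsto_const])
      qed
      then show ?thesis using True by (simp add: continuous_within Y_def)
    next
      case False
      then have "(\<lambda>s. Y s \<omega>) = (\<lambda>_. 0)" by (auto simp: Y_def)
      then show ?thesis by simp
    qed
    show "(\<integral>\<^sup>+\<omega>. c (Y s \<omega>, Y s' \<omega>) * f (Y (s' + w) \<omega>) \<partial>M)
        = (\<integral>\<^sup>+\<omega>. c (Y s \<omega>, Y s' \<omega>) * (\<integral>\<^sup>+\<omega>'. f (Y s' \<omega> + Y w \<omega>') \<partial>M) \<partial>M)"
      if s: "0 \<le> s" "s \<le> s'" "0 \<le> w" and [measurable]: "c \<in> borel_measurable (borel \<Otimes>\<^sub>M borel)"
        "f \<in> borel_measurable borel" for s s' w c and f :: "real \<Rightarrow> ennreal"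
    proof -
      have "(\<integral>\<^sup>+\<omega>. c (Y s \<omega>, Y s' \<omega>) * f (Y (s' + w) \<omega>) \<partial>M) = (\<integral>\<^sup>+\<omega>. c (X s \<omega>, X s' \<omega>) * f (X (s' + w) \<omega>) \<partial>M)"
        using AE_eq s by (intro nn_integral_cong_AE) (auto elim!: eventually_mono)
      also have "\<dots> = (\<integral>\<^sup>+\<omega>. c (X s \<omega>, X s' \<omega>) * (\<integral>\<^sup>+\<omega>'. f (X s' \<omega> + X w \<omega>') \<partial>M) \<partial>M)"
        using s by (rule nn_integral_markov) measurable
      also have "\<dots> = (\<integral>\<^sup>+\<omega>. c (X s \<omega>, X s' \<omega>) * (\<integral>\<^sup>+\<omega>'. f (X s' \<omega> + Y w \<omega>') \<partial>M) \<partial>M)"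
        using Y_X[of w] s
        by (intro nn_integral_cong arg_cong2[where f="(*)"] refl nn_integral_cong_AE) (auto elim!: eventually_mono)
      also have "\<dots> = (\<integral>\<^sup>+\<omega>. c (Y s \<omega>, Y s' \<omega>) * (\<integral>\<^sup>+\<omega>'. f (Y s' \<omega> + Y w \<omega>') \<partial>M) \<partial>M)"
        using AE_eq s by (intro nn_integral_cong_AE) (auto elim!: eventually_mono)
      finally show ?thesis .
    qed
    show "(\<integral>\<^sup>+\<omega>. ennreal (exp (- u * Y t \<omega>)) \<partial>M) = ennreal (exp (- t * \<phi> u))"
      if "0 \<le> t" "0 \<le> u" for t u
    proof -
      have "(\<integral>\<^sup>+\<omega>. ennreal (exp (- u * Y t \<omega>)) \<partial>M) = ennreal (\<integral>\<omega>. exp (- u * Y t \<omega>) \<partial>M)"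
        using Y_nonneg that by (intro nn_integral_eq_integral integrable_const_bound[where B=1]) auto
      also have "(\<integral>\<omega>. exp (- u * Y t \<omega>) \<partial>M) = (\<integral>\<omega>. exp (- u * X t \<omega>) \<partial>M)"
        using Y_X[OF that(1)] random_variable[OF that(1)]
        by (intro integral_cong_AE) (auto elim!: eventually_mono)
      finally show ?thesis using lap that by (simp add: laplace_exponent_def)
    qed
  qed (use Y_mono in auto)
  with AE_eq show ?thesis by blast
qed

context regular_subordinator
begin

lemma Y_nonneg: "0 \<le> Y t \<omega>"
  using Y_mono[of "min 0 t" t \<omega>] Y_nonpos[of "min 0 t" \<omega>] by simp

text \<open>Right-continuous processes are jointly measurable: time is rounded to a grid, where
  countably many random variables suffice, and the mesh tends to 0.\<close>

lemma measurable_Y_pair: "(\<lambda>p. Y (fst p) (snd p)) \<in> borel_measurable (borel \<Otimes>\<^sub>M M)"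
proof (rule borel_measurable_LIMSEQ_real)
  \<comment> \<open>Floor plus one, not ceiling: the rounded time must lie strictly to the right of
    \<open>t\<close> for the limit to be taken along \<open>at_right t\<close>.\<close>
  define d where "d n t = (real_of_int \<lfloor>real (Suc n) * t\<rfloor> + 1) / real (Suc n)" for n t
  have d: "t < d n t" "d n t \<le> t + 1 / real (Suc n)" for n t
  proof -
    have "real (Suc n) * t < real_of_int \<lfloor>real (Suc n) * t\<rfloor> + 1" by linarith
    then show "t < d n t" unfolding d_def by (subst less_divide_eq) (simp add: mult.commute)
    have "real_of_int \<lfloor>real (Suc n) * t\<rfloor> + 1 \<le> real (Suc n) * t + 1" by linarith
    then have "d n t \<le> (real (Suc n) * t + 1) / real (Suc n)" unfolding d_def by (intro divide_right_mono) auto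
    also have "\<dots> = t + 1 / real (Suc n)" by (simp del: of_nat_Suc add: add_divide_distrib)
    finally show "d n t \<le> t + 1 / real (Suc n)" .
  qed
  show "(\<lambda>n. Y (d n (fst p)) (snd p)) \<longlonglongrightarrow> Y (fst p) (snd p)" for p
  proof -
    have "(\<lambda>n. d n (fst p)) \<longlonglongrightarrow> fst p"
    proof (rule tendsto_sandwich[of "\<lambda>_. fst p" _ _ "\<lambda>n. fst p + 1 / real (Suc n)"])
      show "(\<lambda>n. fst p + 1 / real (Suc n)) \<longlonglongrightarrow> fst p"
        using tendsto_add[OF tendsto_const LIMSEQ_Suc[OF lim_const_over_n]] by auto
    qed (use d in \<open>simp_all add: less_imp_le del: of_nat_Suc\<close>)
    then have "filterlim (\<lambda>n. d n (fst p)) (at_right (fst p)) sequentially"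
      using d(1) less_imp_neq[OF d(1)] by (auto simp: filterlim_at intro!: always_eventually dest: sym)
    moreover have "((\<lambda>s. Y s (snd p)) \<longlongrightarrow> Y (fst p) (snd p)) (at_right (fst p))"
      using Y_right_continuous[of "fst p" "snd p"] by (simp add: continuous_within)
    ultimately show ?thesis by (rule filterlim_compose[rotated])
  qed
  show "(\<lambda>p. Y (d n (fst p)) (snd p)) \<in> borel_measurable (borel \<Otimes>\<^sub>M M)" for n
  proof -
    have "(\<lambda>p. (\<lambda>i p. Y ((real_of_int i + 1) / real (Suc n)) (snd p)) \<lfloor>real (Suc n) * fst p\<rfloor> p)
        \<in> borel_measurable (borel \<Otimes>\<^sub>M M)"
      by (rule measurable_compose_countable) measurable
    then show ?thesis by (simp add: d_def)
  qed
qed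

lemma measurable_Y_compose [measurable (raw)]:
  assumes [measurable]: "f \<in> borel_measurable N" "g \<in> N \<rightarrow>\<^sub>M M"
  shows "(\<lambda>x. Y (f x) (g x)) \<in> borel_measurable N"
proof -
  have "(\<lambda>x. (f x, g x)) \<in> N \<rightarrow>\<^sub>M borel \<Otimes>\<^sub>M M" by measurable
  from measurable_compose[OF this measurable_Y_pair] show ?thesis by simp
qed

subsection \<open>Occupation times and potentials\<close>

definition occupation :: "real \<Rightarrow> (real \<Rightarrow> ennreal) \<Rightarrow> real \<Rightarrow> ennreal" where
  "occupation t f x = (\<integral>\<^sup>+\<omega>. (\<integral>\<^sup>+s\<in>{0..t}. f (x + Y s \<omega>) \<partial>lborel) \<partial>M)"

sublocale time_space: pair_sigma_finite lborel M ..

text \<open>Fubini moves the time integral outside, where the Markov property at a fixed time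
  applies, and then back inside.\<close>

lemma nn_integral_markov_occupation:
  assumes s: "0 \<le> s" "s \<le> s'"
    and [measurable]: "c \<in> borel_measurable (borel \<Otimes>\<^sub>M borel)" "f \<in> borel_measurable borel"
  shows "(\<integral>\<^sup>+\<omega>. c (Y s \<omega>, Y s' \<omega>) * (\<integral>\<^sup>+u\<in>{s'..s' + t}. f (x + Y u \<omega>) \<partial>lborel) \<partial>M)
    = (\<integral>\<^sup>+\<omega>. c (Y s \<omega>, Y s' \<omega>) * occupation t f (x + Y s' \<omega>) \<partial>M)"
proof -
  have shift: "(\<integral>\<^sup>+u\<in>{s'..s' + t}. f (x + Y u \<omega>) \<partial>lborel) = (\<integral>\<^sup>+w\<in>{0..t}. f (x + Y (s' + w) \<omega>) \<partial>lborel)"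
    if "\<omega> \<in> space M" for \<omega>
  proof -
    have "(\<lambda>u. f (x + Y u \<omega>) * indicator {s'..s' + t} u) \<in> borel_measurable borel"
      using that by measurable
    from nn_integral_real_affine[OF this, of 1 s'] show ?thesis
      by (auto intro!: nn_integral_cong split: split_indicator)
  qed
  have "(\<integral>\<^sup>+\<omega>. c (Y s \<omega>, Y s' \<omega>) * (\<integral>\<^sup>+u\<in>{s'..s' + t}. f (x + Y u \<omega>) \<partial>lborel) \<partial>M)
      = (\<integral>\<^sup>+\<omega>. \<integral>\<^sup>+w. indicator {0..t} w * (c (Y s \<omega>, Y s' \<omega>) * f (x + Y (s' + w) \<omega>)) \<partial>lborel \<partial>M)"
    by (intro nn_integral_cong) (simp add: shift nn_integral_cmult[symmetric] mult_ac)
  also have "\<dots> = (\<integral>\<^sup>+w. \<integral>\<^sup>+\<omega>. indicator {0..t} w * (c (Y s \<omega>, Y s' \<omega>) * f (x + Y (s' + w) \<omega>)) \<partial>M \<partial>lborel)"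
    by (rule time_space.Fubini') measurable
  also have "\<dots> = (\<integral>\<^sup>+w. indicator {0..t} w * (\<integral>\<^sup>+\<omega>. c (Y s \<omega>, Y s' \<omega>) * f (x + Y (s' + w) \<omega>) \<partial>M) \<partial>lborel)"
    by (intro nn_integral_cong nn_integral_cmult) measurable
  also have "\<dots> = (\<integral>\<^sup>+w. indicator {0..t} w * (\<integral>\<^sup>+\<omega>. c (Y s \<omega>, Y s' \<omega>) * (\<integral>\<^sup>+\<omega>'. f (x + (Y s' \<omega> + Y w \<omega>')) \<partial>M) \<partial>M) \<partial>lborel)"
  proof (intro nn_integral_cong)
    fix w :: real
    show "indicator {0..t} w * (\<integral>\<^sup>+\<omega>. c (Y s \<omega>, Y s' \<omega>) * f (x + Y (s' + w) \<omega>) \<partial>M)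
      = indicator {0..t} w * (\<integral>\<^sup>+\<omega>. c (Y s \<omega>, Y s' \<omega>) * (\<integral>\<^sup>+\<omega>'. f (x + (Y s' \<omega> + Y w \<omega>')) \<partial>M) \<partial>M)"
      using Y_markov[OF s, of w c "\<lambda>y. f (x + y)"] by (cases "0 \<le> w") auto
  qed
  also have "\<dots> = (\<integral>\<^sup>+w. \<integral>\<^sup>+\<omega>. indicator {0..t} w * (c (Y s \<omega>, Y s' \<omega>) * (\<integral>\<^sup>+\<omega>'. f (x + (Y s' \<omega> + Y w \<omega>')) \<partial>M)) \<partial>M \<partial>lborel)"
    by (intro nn_integral_cong nn_integral_cmult[symmetric]) measurable
  also have "\<dots> = (\<integral>\<^sup>+\<omega>. \<integral>\<^sup>+w. indicator {0..t} w * (c (Y s \<omega>, Y s' \<omega>) * (\<integral>\<^sup>+\<omega>'. f (x + (Y s' \<omega> + Y w \<omega>')) \<partial>M)) \<partial>lborel \<partial>M)"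
    by (rule time_space.Fubini'[symmetric]) measurable
  also have "\<dots> = (\<integral>\<^sup>+\<omega>. c (Y s \<omega>, Y s' \<omega>) * occupation t f (x + Y s' \<omega>) \<partial>M)"
  proof (intro nn_integral_cong)
    fix \<omega> assume [simp]: "\<omega> \<in> space M"
    have "(\<integral>\<^sup>+w. indicator {0..t} w * (c (Y s \<omega>, Y s' \<omega>) * (\<integral>\<^sup>+\<omega>'. f (x + (Y s' \<omega> + Y w \<omega>')) \<partial>M)) \<partial>lborel)
      = (\<integral>\<^sup>+w. c (Y s \<omega>, Y s' \<omega>) * (\<integral>\<^sup>+\<omega>'. f (x + Y s' \<omega> + Y w \<omega>') * indicator {0..t} w \<partial>M) \<partial>lborel)"
      by (intro nn_integral_cong, subst nn_integral_multc) (auto simp: mult_ac add.assoc)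
    also have "\<dots> = c (Y s \<omega>, Y s' \<omega>) * (\<integral>\<^sup>+w. \<integral>\<^sup>+\<omega>'. f (x + Y s' \<omega> + Y w \<omega>') * indicator {0..t} w \<partial>M \<partial>lborel)"
      by (intro nn_integral_cmult) measurable
    also have "(\<integral>\<^sup>+w. \<integral>\<^sup>+\<omega>'. f (x + Y s' \<omega> + Y w \<omega>') * indicator {0..t} w \<partial>M \<partial>lborel) = occupation t f (x + Y s' \<omega>)"
      unfolding occupation_def by (rule time_space.Fubini'[symmetric]) measurable
    finally show "(\<integral>\<^sup>+w. indicator {0..t} w * (c (Y s \<omega>, Y s' \<omega>) * (\<integral>\<^sup>+\<omega>'. f (x + (Y s' \<omega> + Y w \<omega>')) \<partial>M)) \<partial>lborel)
      = c (Y s \<omega>, Y s' \<omega>) * occupation t f (x + Y s' \<omega>)" .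
  qed
  finally show ?thesis .
qed

lemma nn_integral_markov_occupation_le:
  assumes s: "0 \<le> s" "s \<le> s'"
    and [measurable]: "c \<in> borel_measurable (borel \<Otimes>\<^sub>M borel)" "f \<in> borel_measurable borel"
  shows "(\<integral>\<^sup>+\<omega>. c (Y s \<omega>, Y s' \<omega>) * (\<integral>\<^sup>+u\<in>{s'..s' + t}. f (x + Y u \<omega>) \<partial>lborel) \<partial>M)
    \<le> (\<integral>\<^sup>+\<omega>. c (Y s \<omega>, Y s' \<omega>) \<partial>M) * (SUP x. occupation t f x)"
proof -
  have "(\<integral>\<^sup>+\<omega>. c (Y s \<omega>, Y s' \<omega>) * (\<integral>\<^sup>+u\<in>{s'..s' + t}. f (x + Y u \<omega>) \<partial>lborel) \<partial>M)
      \<le> (\<integral>\<^sup>+\<omega>. c (Y s \<omega>, Y s' \<omega>) * (SUP x. occupation t f x) \<partial>M)"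
    unfolding nn_integral_markov_occupation[OF assms]
    by (intro nn_integral_mono mult_left_mono SUP_upper) auto
  also have "\<dots> = (\<integral>\<^sup>+\<omega>. c (Y s \<omega>, Y s' \<omega>) \<partial>M) * (SUP x. occupation t f x)"
    by (intro nn_integral_multc) measurable
  finally show ?thesis .
qed

definition potential :: "real \<Rightarrow> real measure" where
  "potential a = distr (density (lborel \<Otimes>\<^sub>M M) (\<lambda>(s, \<omega>). ennreal (exp (- a * s)) * indicator {0..} s))
     borel (\<lambda>(s, \<omega>). Y s \<omega>)"

lemma sets_potential [simp, measurable_cong]: "sets (potential a) = sets borel"
  by (simp add: potential_def)

text \<open>The first form, time outside, computes the Laplace transform; the second, time inside,
  allows estimates path by path.\<close>

lemma nn_integral_potential:
  assumes [measurable]: "f \<in> borel_measurable borel"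
  shows "(\<integral>\<^sup>+z. f z \<partial>potential a) = (\<integral>\<^sup>+s\<in>{0..}. ennreal (exp (- a * s)) * (\<integral>\<^sup>+\<omega>. f (Y s \<omega>) \<partial>M) \<partial>lborel)"
    and "(\<integral>\<^sup>+z. f z \<partial>potential a) = (\<integral>\<^sup>+\<omega>. (\<integral>\<^sup>+s\<in>{0..}. ennreal (exp (- a * s)) * f (Y s \<omega>) \<partial>lborel) \<partial>M)"
proof -
  let ?g = "\<lambda>s \<omega>. ennreal (exp (- a * s)) * indicator {0..} s * f (Y s \<omega>)"
  have "(\<integral>\<^sup>+z. f z \<partial>potential a) = (\<integral>\<^sup>+p. ?g (fst p) (snd p) \<partial>(lborel \<Otimes>\<^sub>M M))"
    unfolding potential_def
    by (subst nn_integral_distr, measurable, subst nn_integral_density) (auto simp: split_beta')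
  also have "\<dots> = (\<integral>\<^sup>+s. \<integral>\<^sup>+\<omega>. ?g s \<omega> \<partial>M \<partial>lborel)"
    by (subst nn_integral_fst[symmetric]) auto
  finally have eq: "(\<integral>\<^sup>+z. f z \<partial>potential a) = (\<integral>\<^sup>+s. \<integral>\<^sup>+\<omega>. ?g s \<omega> \<partial>M \<partial>lborel)" .
  show "(\<integral>\<^sup>+z. f z \<partial>potential a) = (\<integral>\<^sup>+s\<in>{0..}. ennreal (exp (- a * s)) * (\<integral>\<^sup>+\<omega>. f (Y s \<omega>) \<partial>M) \<partial>lborel)"
    unfolding eq by (intro nn_integral_cong, subst nn_integral_cmult) (auto simp: mult_ac)
  have "(\<integral>\<^sup>+s. \<integral>\<^sup>+\<omega>. ?g s \<omega> \<partial>M \<partial>lborel) = (\<integral>\<^sup>+\<omega>. \<integral>\<^sup>+s. ?g s \<omega> \<partial>lborel \<partial>M)"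
    by (rule time_space.Fubini'[symmetric]) measurable
  then show "(\<integral>\<^sup>+z. f z \<partial>potential a) = (\<integral>\<^sup>+\<omega>. (\<integral>\<^sup>+s\<in>{0..}. ennreal (exp (- a * s)) * f (Y s \<omega>) \<partial>lborel) \<partial>M)"
    unfolding eq by (simp add: mult_ac)
qed

text \<open>Markov's inequality for \<open>exp (- Y t / r)\<close>, with the rate matched to the
  level. The companion \<open>emeasure_ge_le\<close> applies it to
  \<open>1 - exp (- Y t / r)\<close>, which is at least \<open>1 - exp (-1)\<close> where
  \<open>r \<le> Y t\<close>.\<close>

lemma emeasure_less_le:
  assumes "0 \<le> t" "0 < r"
  shows "emeasure M {\<omega> \<in> space M. Y t \<omega> < r} \<le> ennreal (exp 1 * exp (- t * \<phi> (inverse r)))"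
proof -
  have "emeasure M {\<omega> \<in> space M. Y t \<omega> < r} = (\<integral>\<^sup>+\<omega>. indicator {\<omega> \<in> space M. Y t \<omega> < r} \<omega> \<partial>M)"
    by simp
  also have "\<dots> \<le> (\<integral>\<^sup>+\<omega>. ennreal (exp 1) * ennreal (exp (- inverse r * Y t \<omega>)) \<partial>M)"
  proof (intro nn_integral_mono)
    fix \<omega>
    have "1 \<le> exp 1 * exp (- inverse r * Y t \<omega>)" if "Y t \<omega> < r"
      using that assms by (simp add: mult_exp_exp field_simps)
    then show "indicator {\<omega> \<in> space M. Y t \<omega> < r} \<omega> \<le> ennreal (exp 1) * ennreal (exp (- inverse r * Y t \<omega>))"
      by (auto simp: ennreal_mult'[symmetric] split: split_indicator)
  qed
  also have "\<dots> = ennreal (exp 1) * ennreal (exp (- t * \<phi> (inverse r)))"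
    using assms Y_laplace[of t "inverse r"] by (simp add: nn_integral_cmult)
  finally show ?thesis by (simp add: ennreal_mult')
qed

lemma emeasure_ge_le:
  assumes "0 \<le> t" "0 < r"
  shows "ennreal (1 - exp (-1)) * emeasure M {\<omega> \<in> space M. r \<le> Y t \<omega>} \<le> ennreal (1 - exp (- t * \<phi> (inverse r)))"
proof -
  have "ennreal (1 - exp (-1)) * emeasure M {\<omega> \<in> space M. r \<le> Y t \<omega>}
      = (\<integral>\<^sup>+\<omega>. ennreal (1 - exp (-1)) * indicator {\<omega> \<in> space M. r \<le> Y t \<omega>} \<omega> \<partial>M)"
    by (subst nn_integral_cmult_indicator) auto
  also have "\<dots> \<le> (\<integral>\<^sup>+\<omega>. 1 - ennreal (exp (- inverse r * Y t \<omega>)) \<partial>M)"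
  proof (intro nn_integral_mono)
    fix \<omega>
    have "ennreal (1 - exp (-1)) \<le> ennreal (1 - exp (- inverse r * Y t \<omega>))" if "r \<le> Y t \<omega>"
      using that assms by (intro ennreal_leI) (simp add: field_simps)
    then show "ennreal (1 - exp (-1)) * indicator {\<omega> \<in> space M. r \<le> Y t \<omega>} \<omega> \<le> 1 - ennreal (exp (- inverse r * Y t \<omega>))"
      using ennreal_minus[of "exp (- inverse r * Y t \<omega>)" 1]
      by (auto simp del: mult_minus_left split: split_indicator)
  qed
  also have "\<dots> = 1 - ennreal (exp (- t * \<phi> (inverse r)))"
    using assms Y_laplace[of t "inverse r"] Y_nonneg
    by (subst nn_integral_diff) (auto simp: emeasure_space_1)
  finally show ?thesis by (simp add: ennreal_minus ennreal_1[symmetric] del: ennreal_1)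
qed

lemma exponent_nonneg:
  assumes "0 \<le> u"
  shows "0 \<le> \<phi> u"
proof -
  have "ennreal (exp (- 1 * \<phi> u)) = (\<integral>\<^sup>+\<omega>. ennreal (exp (- u * Y 1 \<omega>)) \<partial>M)"
    using assms by (subst Y_laplace) auto
  also have "\<dots> \<le> (\<integral>\<^sup>+\<omega>. 1 \<partial>M)"
    using assms Y_nonneg by (intro nn_integral_mono) simp
  finally show ?thesis by (simp add: emeasure_space_1)
qed

lemma exponent_mono:
  assumes "0 \<le> u" "u \<le> v"
  shows "\<phi> u \<le> \<phi> v"
proof -
  have "ennreal (exp (- 1 * \<phi> v)) = (\<integral>\<^sup>+\<omega>. ennreal (exp (- v * Y 1 \<omega>)) \<partial>M)"
    using assms by (subst Y_laplace) auto
  also have "\<dots> \<le> (\<integral>\<^sup>+\<omega>. ennreal (exp (- u * Y 1 \<omega>)) \<partial>M)"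
    using assms Y_nonneg by (intro nn_integral_mono) (simp add: mult_right_mono)
  also have "\<dots> = ennreal (exp (- 1 * \<phi> u))"
    using assms by (subst Y_laplace) auto
  finally show ?thesis by simp
qed

lemma occupation_le_const:
  assumes "\<And>y. f y \<le> ennreal m" "0 \<le> m" "0 \<le> t"
  shows "occupation t f x \<le> ennreal (m * t)"
proof -
  have "occupation t f x \<le> (\<integral>\<^sup>+\<omega>. (\<integral>\<^sup>+s\<in>{0..t}. ennreal m \<partial>lborel) \<partial>M)"
    unfolding occupation_def by (intro nn_integral_mono mult_right_mono assms) auto
  also have "\<dots> = ennreal (m * t)"
    using assms by (simp add: nn_integral_cmult_indicator emeasure_space_1 ennreal_mult)
  finally show ?thesis .
qed

section \<open>Short times against short ranges\<close>

lemma potential_le_occupation: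
  assumes a: "0 \<le> a" and t: "0 < t" and r: "0 < r" and small: "exp (- t * \<phi> (inverse r)) \<le> 1 / 2"
    and [measurable]: "f \<in> borel_measurable borel"
  shows "(\<integral>\<^sup>+z\<in>{..<r}. f (x + z) \<partial>potential a) \<le> ennreal (2 * exp 1) * (SUP x. occupation t f x)"
proof -
  define H where "H = (SUP x. occupation t f x)"
  define c where "c = exp (- t * \<phi> (inverse r))"
  have c: "0 \<le> c" "c \<le> 1 / 2" using small by (auto simp: c_def)
  have "(\<integral>\<^sup>+z\<in>{..<r}. f (x + z) \<partial>potential a)
      = (\<integral>\<^sup>+\<omega>. (\<integral>\<^sup>+s\<in>{0..}. ennreal (exp (- a * s)) * (f (x + Y s \<omega>) * indicator {..<r} (Y s \<omega>)) \<partial>lborel) \<partial>M)"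
    by (rule nn_integral_potential(2)) measurable
  also have "\<dots> \<le> (\<integral>\<^sup>+\<omega>. (\<integral>\<^sup>+s. (\<Sum>k. indicator {..<r} (Y (real k * t) \<omega>) *
      (f (x + Y s \<omega>) * indicator {real k * t..real k * t + t} s)) \<partial>lborel) \<partial>M)"
  proof (intro nn_integral_mono)
    fix \<omega> s
    show "ennreal (exp (- a * s)) * (f (x + Y s \<omega>) * indicator {..<r} (Y s \<omega>)) * indicator {0..} s
      \<le> (\<Sum>k. indicator {..<r} (Y (real k * t) \<omega>) * (f (x + Y s \<omega>) * indicator {real k * t..real k * t + t} s))"
      (is "_ \<le> suminf ?g")
    proof (cases "0 \<le> s \<and> Y s \<omega> < r")
      case True
      \<comment> \<open>The time block containing \<open>s\<close>. As paths increase,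
        \<open>Y s < r\<close> forces \<open>Y (k * t) < r\<close> at its start, so the block is
        counted only on an event known when it begins.\<close>
      define k where "k = nat \<lfloor>s / t\<rfloor>"
      have "0 \<le> s / t" using True t by simp
      then have "real k \<le> s / t" "s / t \<le> real k + 1" by (auto simp: k_def)
      then have k: "real k * t \<le> s" "s \<le> real k * t + t" using t by (auto simp: field_simps)
      have "Y (real k * t) \<omega> < r" using True Y_mono[OF k(1), of \<omega>] by linarith
      then have g: "?g k = f (x + Y s \<omega>)" using k by simp
      have "ennreal (exp (- a * s)) * f (x + Y s \<omega>) \<le> 1 * f (x + Y s \<omega>)"
        using a True by (intro mult_right_mono) auto
      also have "\<dots> = sum ?g {k}" using g by simp
      also have "\<dots> \<le> suminf ?g" by (intro sum_le_suminf) auto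
      finally show ?thesis using True by simp
    qed auto
  qed
  also have "\<dots> = (\<integral>\<^sup>+\<omega>. (\<Sum>k. indicator {..<r} (Y (real k * t) \<omega>) *
      (\<integral>\<^sup>+s\<in>{real k * t..real k * t + t}. f (x + Y s \<omega>) \<partial>lborel)) \<partial>M)"
    by (intro nn_integral_cong, subst nn_integral_suminf) (auto simp: nn_integral_cmult)
  also have "\<dots> = (\<Sum>k. \<integral>\<^sup>+\<omega>. indicator {..<r} (Y (real k * t) \<omega>) *
      (\<integral>\<^sup>+s\<in>{real k * t..real k * t + t}. f (x + Y s \<omega>) \<partial>lborel) \<partial>M)"
    by (intro nn_integral_suminf) measurable
  \<comment> \<open>Each block contributes at most \<open>H\<close> times the probability of still
    being below \<open>r\<close> at its start, which decays like \<open>c ^ k\<close>. As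
    \<open>c \<le> 1 / 2\<close>, the geometric series is at most 2.\<close>
  also have "\<dots> \<le> (\<Sum>k. ennreal (exp 1 * c ^ k) * H)"
  proof (intro suminf_le)
    fix k
    have "(\<integral>\<^sup>+\<omega>. indicator {..<r} (Y (real k * t) \<omega>) *
        (\<integral>\<^sup>+s\<in>{real k * t..real k * t + t}. f (x + Y s \<omega>) \<partial>lborel) \<partial>M)
        \<le> (\<integral>\<^sup>+\<omega>. indicator {..<r} (Y (real k * t) \<omega>) \<partial>M) * H"
      using nn_integral_markov_occupation_le[of "real k * t" "real k * t" "\<lambda>(y, _). indicator {..<r} y" f x t] t
      by (simp add: H_def)
    also have "(\<integral>\<^sup>+\<omega>. indicator {..<r} (Y (real k * t) \<omega>) \<partial>M) = emeasure M {\<omega> \<in> space M. Y (real k * t) \<omega> < r}"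
    proof -
      have "(\<integral>\<^sup>+\<omega>. indicator {..<r} (Y (real k * t) \<omega>) \<partial>M)
          = (\<integral>\<^sup>+\<omega>. indicator {\<omega> \<in> space M. Y (real k * t) \<omega> < r} \<omega> \<partial>M)"
        by (intro nn_integral_cong) (auto split: split_indicator)
      then show ?thesis by simp
    qed
    also have "\<dots> \<le> ennreal (exp 1 * exp (- (real k * t) * \<phi> (inverse r)))"
      using t r by (intro emeasure_less_le) auto
    also have "exp (- (real k * t) * \<phi> (inverse r)) = c ^ k"
      by (simp add: c_def exp_of_nat_mult[symmetric] mult.assoc)
    finally show "(\<integral>\<^sup>+\<omega>. indicator {..<r} (Y (real k * t) \<omega>) *
        (\<integral>\<^sup>+s\<in>{real k * t..real k * t + t}. f (x + Y s \<omega>) \<partial>lborel) \<partial>M) \<le> ennreal (exp 1 * c ^ k) * H"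
      by (simp add: mult_right_mono)
  qed auto
  also have "\<dots> = ennreal (exp 1 * (1 / (1 - c))) * H"
  proof -
    have "(\<Sum>k. ennreal (exp 1 * c ^ k)) = ennreal (exp 1 * (1 / (1 - c)))"
      using c by (intro suminf_ennreal_eq sums_mult geometric_sums) auto
    then show ?thesis by simp
  qed
  also have "\<dots> \<le> ennreal (2 * exp 1) * H"
    using c by (intro mult_right_mono ennreal_leI) (auto simp: field_simps)
  finally show ?thesis by (simp add: H_def)
qed

text \<open>
  The grid replaces the first passage time above \<open>r\<close>, so that only the Markov property at fixed
  times is needed; the error term is the time spent in the grid cell of the crossing.
\<close>

lemma occupation_le_grid:
  assumes t: "0 < t" and r: "0 < r" and n: "0 < n" and m: "0 \<le> m" "\<And>y. f y \<le> ennreal m"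
    and [measurable]: "f \<in> borel_measurable borel" and \<omega>: "\<omega> \<in> space M"
  defines "\<tau> \<equiv> \<lambda>i. real i * t / real n"
  shows "(\<integral>\<^sup>+s\<in>{0..t}. f (x + Y s \<omega>) \<partial>lborel)
    \<le> (\<integral>\<^sup>+s\<in>{0..t}. f (x + Y s \<omega>) * indicator {..<r} (Y s \<omega>) \<partial>lborel) + ennreal (m * t / real n)
      + (\<Sum>i<n. indicator {..<r} (Y (\<tau> i) \<omega>) * indicator {r..} (Y (\<tau> (Suc i)) \<omega>) *
          (\<integral>\<^sup>+s\<in>{\<tau> (Suc i)..\<tau> (Suc i) + t}. f (x + Y s \<omega>) \<partial>lborel))"
    (is "?L \<le> ?A + ?B + (\<Sum>i<n. ?J i)")
proof (cases "Y t \<omega> < r")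
  case True
  then have "Y s \<omega> < r" if "s \<le> t" for s using Y_mono[OF that, of \<omega>] by linarith
  then have "?L = ?A" by (intro nn_integral_cong) (auto split: split_indicator)
  then show ?thesis by (simp add: add_increasing2)
next
  case False
  \<comment> \<open>The grid cell of the first crossing; the last cell is a witness since
    \<open>\<tau> n = t\<close>. Before it the path is below \<open>r\<close>, inside it
    \<open>f \<le> m\<close> on a time of length \<open>t / n\<close>, and after it a window of
    length \<open>t\<close> covers the rest of \<open>[0,t]\<close>.\<close>
  define i where "i = (LEAST i. r \<le> Y (\<tau> (Suc i)) \<omega>)"
  have ex: "r \<le> Y (\<tau> (Suc (n - 1))) \<omega>" using False n by (simp add: \<tau>_def)
  have i: "r \<le> Y (\<tau> (Suc i)) \<omega>" unfolding i_def by (rule LeastI[of _ "n - 1"]) (rule ex)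
  have "i \<le> n - 1" unfolding i_def by (rule Least_le) (rule ex)
  then have "i < n" using n by simp
  have i0: "Y (\<tau> i) \<omega> < r"
  proof (cases i)
    case 0
    then show ?thesis using r by (simp add: \<tau>_def Y_nonpos)
  next
    case (Suc j)
    then have "\<not> r \<le> Y (\<tau> (Suc j)) \<omega>" unfolding i_def by (intro not_less_Least) (simp add: i_def[symmetric])
    then show ?thesis using Suc by simp
  qed
  have \<tau>: "0 \<le> \<tau> (Suc i)" "\<tau> (Suc i) = \<tau> i + t / real n"
    using t by (auto simp: \<tau>_def add_divide_distrib distrib_right)
  have [measurable]: "(\<lambda>s. Y s \<omega>) \<in> borel_measurable borel" using \<omega> by measurable
  have "?L \<le> (\<integral>\<^sup>+s. f (x + Y s \<omega>) * indicator {..<r} (Y s \<omega>) * indicator {0..t} s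
      + ennreal m * indicator {\<tau> i..\<tau> (Suc i)} s
      + f (x + Y s \<omega>) * indicator {\<tau> (Suc i)..\<tau> (Suc i) + t} s \<partial>lborel)"
  proof (intro nn_integral_mono)
    fix s
    consider "s < \<tau> i" | "\<tau> i \<le> s" "s \<le> \<tau> (Suc i)" | "\<tau> (Suc i) < s" by linarith
    then show "f (x + Y s \<omega>) * indicator {0..t} s
      \<le> f (x + Y s \<omega>) * indicator {..<r} (Y s \<omega>) * indicator {0..t} s
      + ennreal m * indicator {\<tau> i..\<tau> (Suc i)} s
      + f (x + Y s \<omega>) * indicator {\<tau> (Suc i)..\<tau> (Suc i) + t} s"
    proof cases
      case 1
      then have "Y s \<omega> < r" using Y_mono[of s "\<tau> i" \<omega>] i0 by linarith
      then show ?thesis by (simp add: add_increasing2 add.assoc)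
    next
      case 2
      have "f (x + Y s \<omega>) * indicator {0..t} s \<le> ennreal m * 1"
        by (intro mult_mono m) (auto split: split_indicator)
      then show ?thesis using 2 by (auto simp: add_increasing2 add_increasing)
    next
      case 3
      then show ?thesis using \<tau> by (auto simp: add_increasing split: split_indicator)
    qed
  qed
  also have "\<dots> = ?A + ennreal m * ennreal (\<tau> (Suc i) - \<tau> i)
      + (\<integral>\<^sup>+s\<in>{\<tau> (Suc i)..\<tau> (Suc i) + t}. f (x + Y s \<omega>) \<partial>lborel)"
    using \<tau>(2) t by (simp add: nn_integral_add nn_integral_cmult_indicator)
  also have "ennreal m * ennreal (\<tau> (Suc i) - \<tau> i) = ?B"
    using \<tau>(2) m by (simp add: ennreal_mult'[symmetric])
  also have "(\<integral>\<^sup>+s\<in>{\<tau> (Suc i)..\<tau> (Suc i) + t}. f (x + Y s \<omega>) \<partial>lborel) = ?J i"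
    using i i0 by simp
  also have "?J i \<le> (\<Sum>i<n. ?J i)"
    using \<open>i < n\<close> by (intro member_le_sum) auto
  finally show ?thesis by (simp add: add_left_mono)
qed

text \<open>Boundedness of \<open>f\<close> serves twice: it makes \<open>H\<close> finite, so that
  half of it can be absorbed, and it makes the error of the crossing cell at most
  \<open>m * t / n\<close>, which vanishes as the grid is refined.\<close>

lemma occupation_le_potential_bounded:
  assumes t: "0 < t" and r: "0 < r" and a: "0 \<le> a"
    and half: "emeasure M {\<omega> \<in> space M. r \<le> Y t \<omega>} \<le> ennreal (1 / 2)"
    and m: "0 \<le> m" "\<And>y. f y \<le> ennreal m" and [measurable]: "f \<in> borel_measurable borel"
  shows "(SUP x. occupation t f x) \<le> 2 * (ennreal (exp (a * t)) * (SUP x. \<integral>\<^sup>+z\<in>{..<r}. f (x + z) \<partial>potential a))"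
proof -
  define H where "H = (SUP x. occupation t f x)"
  define K where "K = ennreal (exp (a * t)) * (SUP x. \<integral>\<^sup>+z\<in>{..<r}. f (x + z) \<partial>potential a)"
  have fin: "H < \<infinity>"
  proof -
    have "H \<le> ennreal (m * t)" unfolding H_def using t by (intro SUP_least occupation_le_const m) auto
    then show ?thesis by (simp add: le_less_trans)
  qed
  have main: "H \<le> K + ennreal (m * t / real n) + ennreal (1 / 2) * H" if n: "0 < n" for n
  proof (subst (1) H_def, intro SUP_least)
    fix x
    define \<tau> where "\<tau> i = real i * t / real n" for i
    let ?c = "\<lambda>(y, y'). indicator {..<r} y * indicator {r..} y' :: ennreal"
    let ?A = "\<lambda>\<omega>. \<integral>\<^sup>+s\<in>{0..t}. f (x + Y s \<omega>) * indicator {..<r} (Y s \<omega>) \<partial>lborel"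
    let ?J = "\<lambda>i \<omega>. ?c (Y (\<tau> i) \<omega>, Y (\<tau> (Suc i)) \<omega>) * (\<integral>\<^sup>+s\<in>{\<tau> (Suc i)..\<tau> (Suc i) + t}. f (x + Y s \<omega>) \<partial>lborel)"
    have \<tau>: "0 \<le> \<tau> i" "\<tau> i \<le> \<tau> (Suc i)" for i
      using t n by (auto simp: \<tau>_def divide_right_mono)
    have "occupation t f x \<le> (\<integral>\<^sup>+\<omega>. ?A \<omega> + ennreal (m * t / real n) + (\<Sum>i<n. ?J i \<omega>) \<partial>M)"
      unfolding occupation_def \<tau>_def prod.case
      by (intro nn_integral_mono occupation_le_grid t r n m) auto
    also have "\<dots> = (\<integral>\<^sup>+\<omega>. ?A \<omega> \<partial>M) + ennreal (m * t / real n) + (\<Sum>i<n. \<integral>\<^sup>+\<omega>. ?J i \<omega> \<partial>M)"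
      by (simp add: nn_integral_add nn_integral_sum emeasure_space_1)
    also have "\<dots> \<le> K + ennreal (m * t / real n) + ennreal (1 / 2) * H"
    proof (intro add_mono order_refl)
      show "(\<integral>\<^sup>+\<omega>. ?A \<omega> \<partial>M) \<le> K"
      proof -
        have "(\<integral>\<^sup>+\<omega>. ?A \<omega> \<partial>M) \<le> (\<integral>\<^sup>+\<omega>. ennreal (exp (a * t)) *
            (\<integral>\<^sup>+s\<in>{0..}. ennreal (exp (- a * s)) * (f (x + Y s \<omega>) * indicator {..<r} (Y s \<omega>)) \<partial>lborel) \<partial>M)"
        proof (intro nn_integral_mono)
          fix \<omega> assume \<omega>: "\<omega> \<in> space M"
          have [measurable]: "(\<lambda>s. Y s \<omega>) \<in> borel_measurable borel" using \<omega> by measurable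
          have "?A \<omega> \<le> (\<integral>\<^sup>+s. ennreal (exp (a * t)) *
              (ennreal (exp (- a * s)) * (f (x + Y s \<omega>) * indicator {..<r} (Y s \<omega>)) * indicator {0..} s) \<partial>lborel)"
          proof (intro nn_integral_mono)
            fix s
            \<comment> \<open>The factor \<open>exp (a * t)\<close> compensates the discount at all
              times up to \<open>t\<close>.\<close>
            have "1 \<le> exp (a * t) * exp (- a * s)" if "s \<le> t"
              using mult_left_mono[OF that a] by (simp add: mult_exp_exp)
            then have "1 \<le> ennreal (exp (a * t)) * ennreal (exp (- a * s))" if "s \<le> t"
              using that by (simp add: ennreal_mult'[symmetric])
            from mult_right_mono[OF this, of "f (x + Y s \<omega>) * indicator {..<r} (Y s \<omega>)"]
            show "f (x + Y s \<omega>) * indicator {..<r} (Y s \<omega>) * indicator {0..t} s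
              \<le> ennreal (exp (a * t)) *
              (ennreal (exp (- a * s)) * (f (x + Y s \<omega>) * indicator {..<r} (Y s \<omega>)) * indicator {0..} s)"
              by (cases "s \<in> {0..t}") (auto simp: mult.assoc)
          qed
          then show "?A \<omega> \<le> ennreal (exp (a * t)) *
            (\<integral>\<^sup>+s\<in>{0..}. ennreal (exp (- a * s)) * (f (x + Y s \<omega>) * indicator {..<r} (Y s \<omega>)) \<partial>lborel)"
            by (subst (asm) nn_integral_cmult) auto
        qed
        also have "\<dots> = ennreal (exp (a * t)) * (\<integral>\<^sup>+z\<in>{..<r}. f (x + z) \<partial>potential a)"
          by (subst nn_integral_potential(2)) (auto simp: nn_integral_cmult)
        also have "\<dots> \<le> K" unfolding K_def by (intro mult_left_mono SUP_upper) auto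
        finally show ?thesis .
      qed
      have "(\<Sum>i<n. \<integral>\<^sup>+\<omega>. ?J i \<omega> \<partial>M) \<le> (\<Sum>i<n. (\<integral>\<^sup>+\<omega>. ?c (Y (\<tau> i) \<omega>, Y (\<tau> (Suc i)) \<omega>) \<partial>M) * H)"
        unfolding H_def using \<tau> by (intro sum_mono nn_integral_markov_occupation_le) auto
      also have "\<dots> = (\<integral>\<^sup>+\<omega>. (\<Sum>i<n. ?c (Y (\<tau> i) \<omega>, Y (\<tau> (Suc i)) \<omega>)) \<partial>M) * H"
        by (subst nn_integral_sum) (auto simp: sum_distrib_right)
      also have "\<dots> \<le> (\<integral>\<^sup>+\<omega>. indicator {\<omega> \<in> space M. r \<le> Y t \<omega>} \<omega> \<partial>M) * H"
      proof (intro mult_right_mono nn_integral_mono)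
        fix \<omega> assume \<omega>: "\<omega> \<in> space M"
        have "mono (\<lambda>i. Y (\<tau> i) \<omega>)" using \<tau>(2) by (intro incseq_SucI Y_mono)
        from sum_crossing_le[OF this, where n=n and r=r] n \<omega>
        show "(\<Sum>i<n. ?c (Y (\<tau> i) \<omega>, Y (\<tau> (Suc i)) \<omega>)) \<le> indicator {\<omega> \<in> space M. r \<le> Y t \<omega>} \<omega>"
          by (simp add: \<tau>_def indicator_def)
      qed auto
      also have "\<dots> \<le> ennreal (1 / 2) * H"
        using half by (intro mult_right_mono) (subst nn_integral_indicator, auto)
      finally show "(\<Sum>i<n. \<integral>\<^sup>+\<omega>. ?J i \<omega> \<partial>M) \<le> ennreal (1 / 2) * H" .
    qed
    finally show "occupation t f x \<le> K + ennreal (m * t / real n) + ennreal (1 / 2) * H" .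
  qed
  have "H \<le> 2 * K"
  proof (rule ennreal_le_epsilon)
    fix e :: real assume e: "0 < e"
    obtain n where n: "2 * m * t / e < real n" using reals_Archimedean2 by blast
    have "0 \<le> 2 * m * t / e" using m t e by simp
    with n have n0: "0 < n" by (metis le_less_trans of_nat_0_less_iff)
    have "2 * (m * t / real n) \<le> e" using n n0 e by (simp add: field_simps)
    have "H \<le> 2 * (K + ennreal (m * t / real n))" by (intro ennreal_le_double_self main n0 fin)
    also have "\<dots> = 2 * K + ennreal (2 * (m * t / real n))"
      using m t by (subst ennreal_mult) (auto simp: distrib_left)
    also have "\<dots> \<le> 2 * K + ennreal e" by (intro add_left_mono ennreal_leI) fact
    finally show "H \<le> 2 * K + ennreal e" .
  qed
  then show ?thesis by (simp add: H_def K_def)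
qed

text \<open>Truncation at height \<open>m\<close> and monotone convergence: the constants of the
  bounded case do not depend on \<open>m\<close>.\<close>

lemma occupation_le_potential:
  assumes t: "0 < t" and r: "0 < r" and a: "0 \<le> a"
    and half: "emeasure M {\<omega> \<in> space M. r \<le> Y t \<omega>} \<le> ennreal (1 / 2)"
    and [measurable]: "f \<in> borel_measurable borel"
  shows "(SUP x. occupation t f x) \<le> 2 * (ennreal (exp (a * t)) * (SUP x. \<integral>\<^sup>+z\<in>{..<r}. f (x + z) \<partial>potential a))"
    (is "_ \<le> ?R f")
proof (intro SUP_least)
  fix x
  define g where "g m y = min (f y) (of_nat m)" for m :: nat and y
  have [measurable]: "g m \<in> borel_measurable borel" for m unfolding g_def by measurable
  have g_Sup: "(SUP m. g m y) = f y" for y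
  proof -
    have "(SUP m. g m y) = min (f y) (SUP m. of_nat m)"
      unfolding g_def inf_min[symmetric] by (rule inf_SUP[symmetric])
    then show ?thesis by (simp add: ennreal_SUP_of_nat_eq_top)
  qed
  have g_mono: "incseq (\<lambda>m. g m y)" for y
    unfolding g_def incseq_def by (intro allI impI min.mono) auto
  have "occupation t f x = (\<integral>\<^sup>+\<omega>. (\<integral>\<^sup>+s. (SUP m. g m (x + Y s \<omega>) * indicator {0..t} s) \<partial>lborel) \<partial>M)"
    unfolding occupation_def by (simp add: SUP_mult_right_ennreal[symmetric] g_Sup)
  also have "\<dots> = (\<integral>\<^sup>+\<omega>. (SUP m. \<integral>\<^sup>+s. g m (x + Y s \<omega>) * indicator {0..t} s \<partial>lborel) \<partial>M)"
    using g_mono by (intro nn_integral_cong nn_integral_monotone_convergence_SUP)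
      (auto simp: incseq_def le_fun_def intro!: mult_right_mono)
  also have "\<dots> = (SUP m. occupation t (g m) x)"
    unfolding occupation_def using g_mono
    by (intro nn_integral_monotone_convergence_SUP)
      (auto simp: incseq_def le_fun_def intro!: mult_right_mono nn_integral_mono)
  also have "\<dots> \<le> ?R f"
  proof (intro SUP_least)
    fix m
    have "occupation t (g m) x \<le> (SUP x. occupation t (g m) x)" by (rule SUP_upper) auto
    also have "\<dots> \<le> ?R (g m)"
      by (intro occupation_le_potential_bounded[where m="real m"] t r a half)
         (auto simp: g_def ennreal_of_nat_eq_real_of_nat)
    also have "\<dots> \<le> ?R f"
      by (intro mult_left_mono SUP_subset_mono nn_integral_mono mult_right_mono) (auto simp: g_def)
    finally show "occupation t (g m) x \<le> ?R f" .
  qed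
  finally show "occupation t f x \<le> ?R f" .
qed

subsection \<open>Comparison of the potential density with the kernel\<close>

lemma exponent_at_top:
  assumes "\<not> bounded (\<phi> ` {0..})"
  shows "filterlim \<phi> at_top at_top"
  unfolding filterlim_at_top
proof
  fix B :: real
  obtain u where u: "0 \<le> u" "B < \<phi> u"
    using assms exponent_nonneg unfolding bounded_iff by (auto simp: not_le)
  show "eventually (\<lambda>v. B \<le> \<phi> v) at_top"
    using eventually_ge_at_top[of u] by eventually_elim (use u exponent_mono[of u] in force)
qed

text \<open>A zero of \<open>\<phi>\<close> at some \<open>u > 0\<close> forces
  \<open>Y 1 = 0\<close> almost surely, hence \<open>\<phi> = 0\<close> on
  \<open>[0,\<infinity>)\<close>, against unboundedness.\<close>

lemma exponent_pos:
  assumes unbounded: "\<not> bounded (\<phi> ` {0..})" and "0 < u"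
  shows "0 < \<phi> u"
proof (rule ccontr)
  assume "\<not> 0 < \<phi> u"
  then have "\<phi> u = 0" using exponent_nonneg[of u] assms(2) by simp
  have "(\<integral>\<^sup>+\<omega>. 1 - ennreal (exp (- u * Y 1 \<omega>)) \<partial>M) = 1 - ennreal (exp (- 1 * \<phi> u))"
    using assms(2) Y_laplace[of 1 u] Y_nonneg
    by (subst nn_integral_diff) (auto simp: emeasure_space_1)
  also have "\<dots> = 0" using \<open>\<phi> u = 0\<close> by simp
  finally have "AE \<omega> in M. 1 - ennreal (exp (- u * Y 1 \<omega>)) = 0"
    by (subst (asm) nn_integral_0_iff_AE) auto
  then have "AE \<omega> in M. Y 1 \<omega> = 0"
  proof eventually_elim
    case (elim \<omega>)
    then have "ennreal (1 - exp (- u * Y 1 \<omega>)) = 0"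
      using ennreal_minus[of "exp (- u * Y 1 \<omega>)" 1] by simp
    then have "1 \<le> exp (- u * Y 1 \<omega>)" by (simp only: ennreal_eq_0_iff)
    then have "u * Y 1 \<omega> \<le> 0" by simp
    then show ?case using assms(2) Y_nonneg[of 1 \<omega>] by (simp add: mult_le_0_iff)
  qed
  then have "(\<integral>\<^sup>+\<omega>. ennreal (exp (- v * Y 1 \<omega>)) \<partial>M) = (\<integral>\<^sup>+\<omega>. 1 \<partial>M)" for v
    by (intro nn_integral_cong_AE) (auto elim: eventually_mono)
  then have "ennreal (exp (- 1 * \<phi> v)) = ennreal 1" if "0 \<le> v" for v
    using Y_laplace[of 1 v] that by (simp add: emeasure_space_1)
  then have "\<phi> v = 0" if "0 \<le> v" for v
    using that by (simp add: ennreal_eq_1 del: ennreal_1)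
  then have "\<phi> ` {0..} \<subseteq> {0}" by auto
  with unbounded show False by (meson bounded_subset bounded_insert bounded_empty)
qed

lemma nn_integral_potential_exp:
  assumes "0 \<le> u" "0 < a + \<phi> u"
  shows "(\<integral>\<^sup>+z. ennreal (exp (- u * z)) \<partial>potential a) = ennreal (1 / (a + \<phi> u))"
proof -
  define l where "l = a + \<phi> u"
  have l: "0 < l" using assms by (simp add: l_def)
  have "(\<integral>\<^sup>+z. ennreal (exp (- u * z)) \<partial>potential a)
      = (\<integral>\<^sup>+s\<in>{0..}. ennreal (exp (- a * s)) * (\<integral>\<^sup>+\<omega>. ennreal (exp (- u * Y s \<omega>)) \<partial>M) \<partial>lborel)"
    by (rule nn_integral_potential(1)) measurable
  also have "\<dots> = (\<integral>\<^sup>+s. ennreal (1 / l) * ennreal (exponential_density l s) \<partial>lborel)"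
  proof (intro nn_integral_cong)
    fix s :: real
    show "ennreal (exp (- a * s)) * (\<integral>\<^sup>+\<omega>. ennreal (exp (- u * Y s \<omega>)) \<partial>M) * indicator {0..} s
      = ennreal (1 / l) * ennreal (exponential_density l s)"
    proof (cases "0 \<le> s")
      case True
      then show ?thesis using l unfolding Y_laplace[OF True assms(1)]
        by (simp add: exponential_density_def ennreal_mult'[symmetric] mult_exp_exp)
           (simp add: l_def algebra_simps)
    qed (simp add: exponential_density_def)
  qed
  also have "\<dots> = ennreal (1 / l) * emeasure (density lborel (exponential_density l)) UNIV"
    by (subst nn_integral_cmult) (auto simp: emeasure_density)
  also have "emeasure (density lborel (exponential_density l)) UNIV = 1"
    using prob_space.emeasure_space_1[OF prob_space_exponential_density[OF l]] by simp
  finally show ?thesis by (simp add: l_def)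
qed

text \<open>Unboundedness of \<open>\<phi>\<close> excludes an atom at 0: the mass of
  \<open>{..0}\<close> is at most \<open>1 / (a + \<phi> u)\<close> for every
  \<open>u > 0\<close>.\<close>

lemma laplace_measure_potential:
  assumes unbounded: "\<not> bounded (\<phi> ` {0..})" and a: "0 \<le> a"
  shows "laplace_measure (potential a)"
proof
  note pos = exponent_pos[OF unbounded]
  show "(\<integral>\<^sup>+z. ennreal (exp (- s * z)) \<partial>potential a) < \<infinity>" if "0 < s" for s
    using that pos[OF that] a by (subst nn_integral_potential_exp) auto
  have "emeasure (potential a) {..0} \<le> ennreal (1 / (a + \<phi> u))" if "0 < u" for u
  proof -
    have "emeasure (potential a) {..0} = (\<integral>\<^sup>+z. indicator {..0} z \<partial>potential a)" by simp
    also have "\<dots> \<le> (\<integral>\<^sup>+z. ennreal (exp (- u * z)) \<partial>potential a)"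
    proof (intro nn_integral_mono)
      fix z :: real
      have "ennreal 1 \<le> ennreal (exp (- u * z))" if "z \<le> 0"
        using that \<open>0 < u\<close> by (intro ennreal_leI) (simp add: mult_nonneg_nonpos)
      then show "indicator {..0} z \<le> ennreal (exp (- u * z))"
        by (simp split: split_indicator)
    qed
    also have "\<dots> = ennreal (1 / (a + \<phi> u))"
      using that pos[OF that] a by (intro nn_integral_potential_exp) auto
    finally show ?thesis .
  qed
  then have "eventually (\<lambda>u. emeasure (potential a) {..0} \<le> ennreal (1 / (a + \<phi> u))) at_top"
    by (intro eventually_mono[OF eventually_gt_at_top[of 0]])
  moreover have "((\<lambda>u. ennreal (1 / (a + \<phi> u))) \<longlongrightarrow> ennreal 0) at_top"
    by (intro tendsto_ennrealI real_tendsto_divide_at_top[OF tendsto_const]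
        filterlim_tendsto_add_at_top[OF tendsto_const] exponent_at_top unbounded)
  ultimately have "emeasure (potential a) {..0} \<le> ennreal 0"
    by (intro tendsto_lowerbound) auto
  then have "{..0} \<in> null_sets (potential a)" by (simp add: null_sets_def)
  then show "AE z in potential a. 0 < z"
    by (rule AE_I') auto
qed simp

section \<open>Two-sided density bounds from the special and scaling conditions\<close>

context
  fixes a C \<beta> \<theta>' :: real
  assumes unbounded: "\<not> bounded (\<phi> ` {0..})" and a: "0 \<le> a"
    and special: "special_bernstein (\<lambda>u. a + \<phi> u)"
    and scaling: "0 < \<beta>" "0 \<le> \<theta>'" "1 \<le> C"
      "\<And>\<eta> \<theta>. 1 \<le> \<eta> \<Longrightarrow> \<theta>' < \<theta> \<Longrightarrow>
        deriv \<phi> (\<eta> * \<theta>) / (\<phi> (\<eta> * \<theta>))\<^sup>2 \<le> C * \<eta> powr (- \<beta>) * (deriv \<phi> \<theta> / (\<phi> \<theta>)\<^sup>2)"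
begin

interpretation U: laplace_measure "potential a"
  by (intro laplace_measure_potential unbounded a)

lemma moment_0_potential: "0 < s \<Longrightarrow> U.moment 0 s = 1 / (a + \<phi> s)"
proof -
  assume s: "0 < s"
  have "ennreal (U.moment 0 s) = ennreal (1 / (a + \<phi> s))"
    using U.nn_integral_moment[OF s, of 0] nn_integral_potential_exp[of s a] s a exponent_pos[OF unbounded s]
    by simp
  then show ?thesis using U.moment_nonneg[of 0 s] a exponent_pos[OF unbounded s] by simp
qed

interpretation U: special_laplace_measure "potential a"
proof (rule U.special_laplace_measureI)
  show "bernstein (\<lambda>u. u / (a + \<phi> u))" using special by (simp add: special_bernstein_def)
qed (simp add: moment_0_potential)

abbreviation "ratio s \<equiv> deriv \<phi> s / (\<phi> s)\<^sup>2"

text \<open>Differentiability of \<open>\<phi>\<close> is obtained along the way, by writing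
  \<open>\<phi>\<close> as the reciprocal of the moment of order 0 minus \<open>a\<close>.\<close>

lemma moment_1_potential:
  assumes s: "0 < s"
  shows "U.moment 1 s = deriv \<phi> s / (a + \<phi> s)\<^sup>2"
proof -
  note pos = exponent_pos[OF unbounded]
  have pos': "0 < a + \<phi> s" if "0 < s" for s using pos[OF that] a by simp
  have "(\<phi> has_real_derivative U.moment 1 s * (a + \<phi> s)\<^sup>2) (at s)"
  proof (rule has_field_derivative_transform_within_open)
    show "((\<lambda>s. inverse (U.moment 0 s) - a) has_real_derivative U.moment 1 s * (a + \<phi> s)\<^sup>2) (at s)"
      using s pos'[OF s]
      by (auto intro!: derivative_eq_intros U.has_derivative_moment simp: moment_0_potential power2_eq_square field_simps)
    show "open {0::real<..}" "s \<in> {0<..}" using s by auto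
    show "inverse (U.moment 0 x) - a = \<phi> x" if "x \<in> {0<..}" for x
      using that by (simp add: moment_0_potential)
  qed
  from DERIV_imp_deriv[OF this] show ?thesis using pos'[OF s] by simp
qed

lemma deriv_exponent_nonneg: "0 < s \<Longrightarrow> 0 \<le> deriv \<phi> s"
  using moment_1_potential[of s] U.moment_nonneg[of 1 s] exponent_pos[OF unbounded, of s] a
  by (simp add: zero_le_divide_iff)

lemma moment_1_potential_le: "0 < s \<Longrightarrow> U.moment 1 s \<le> ratio s"
  using exponent_pos[OF unbounded, of s] a deriv_exponent_nonneg[of s]
  by (subst moment_1_potential) (auto intro!: divide_left_mono power_mono mult_pos_pos)

lemma potential_density_upper:
  assumes "0 < z"
  shows "U.potential_density z \<le> ennreal (2 * exp 1 * (deriv \<phi> (inverse z) / (z\<^sup>2 * (\<phi> (inverse z))\<^sup>2)))"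
proof -
  have "U.potential_density z \<le> ennreal (2 * exp 1 / z\<^sup>2 * U.moment 1 (inverse z))"
    by (rule U.potential_density_le) fact
  also have "\<dots> \<le> ennreal (2 * exp 1 / z\<^sup>2 * ratio (inverse z))"
    using assms by (intro ennreal_leI mult_left_mono moment_1_potential_le) auto
  finally show ?thesis by (simp add: mult_ac)
qed

text \<open>\<open>moment_1_le\<close> is used at \<open>s = \<delta> / z\<close>, so that the split
  point is \<open>z\<close> and the higher rate is \<open>1 / z\<close>. The scaling condition with
  \<open>\<eta> = 1 / \<delta>\<close> makes the left part at most \<open>ratio s / 8\<close>, while
  the whole moment is at least \<open>ratio s / 4\<close>. What remains bounds the density at
  \<open>z\<close> below by \<open>s\<^sup>2 * ratio s / 8\<close>.\<close>

lemma potential_density_lower: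
  obtains c r where "0 < c" "0 < r"
    "\<And>z. 0 < z \<Longrightarrow> z < r \<Longrightarrow>
      ennreal (c * (deriv \<phi> (inverse z) / (z\<^sup>2 * (\<phi> (inverse z))\<^sup>2))) \<le> U.potential_density z"
proof -
  \<comment> \<open>\<open>\<delta>\<close> solves \<open>C \<delta>\<^sup>\<beta> = 1 / (8 e)\<close>: then the part of the moment over \<open>z < \<delta> / s\<close> is at most half
    of the lower bound \<open>\<phi>' / (4 \<phi>\<^sup>2)\<close> for the whole.\<close>
  define \<delta> where "\<delta> = (1 / (8 * exp 1 * C)) powr (1 / \<beta>)"
  have small: "0 < 1 / (8 * exp 1 * C)" "1 / (8 * exp 1 * C) \<le> 1"
  proof -
    have "1 * 1 \<le> exp 1 * C" using scaling(3) by (intro mult_mono) auto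
    then show "0 < 1 / (8 * exp 1 * C)" "1 / (8 * exp 1 * C) \<le> 1" using scaling(3) by (auto simp: field_simps)
  qed
  have \<delta>: "0 < \<delta>" "\<delta> \<le> 1"
    unfolding \<delta>_def using small scaling(1) by (auto intro!: powr_le1)
  have \<delta>_powr: "C * \<delta> powr \<beta> = 1 / (8 * exp 1)"
    unfolding \<delta>_def powr_powr using scaling small by (simp add: field_simps)
  have "eventually (\<lambda>s. a \<le> \<phi> s) at_top"
    using exponent_at_top[OF unbounded] by (simp add: filterlim_at_top)
  then obtain s0 where s0: "\<And>s. s0 \<le> s \<Longrightarrow> a \<le> \<phi> s" by (auto simp: eventually_at_top_linorder)
  \<comment> \<open>Beyond \<open>s1\<close> both \<open>a \<le> \<phi> s\<close> and the scaling
    condition are available; the entry 1 keeps it positive.\<close>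
  define s1 where "s1 = max (max s0 \<theta>') 1"
  have s1: "0 < s1" "s0 \<le> s1" "\<theta>' \<le> s1" by (auto simp: s1_def)
  show thesis
  proof (rule that[of "\<delta>\<^sup>2 / 8" "\<delta> / s1"])
    fix z assume z: "0 < z" "z < \<delta> / s1"
    define s where "s = \<delta> / z"
    have s: "s1 < s" "0 < s" "\<delta> / s = z" "s / \<delta> = inverse z"
      using z s1 \<delta> by (auto simp: s_def field_simps)
    have pos: "0 < \<phi> s" "a \<le> \<phi> s" using exponent_pos[OF unbounded s(2)] s0[of s] s(1) s1 by auto
    have ratio_nonneg: "0 \<le> ratio s" using deriv_exponent_nonneg[OF s(2)] by simp
    have "ratio (1 / \<delta> * s) \<le> C * (1 / \<delta>) powr (- \<beta>) * ratio s"
      using \<delta> s s1 by (intro scaling(4)) auto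
    moreover have "C * (1 / \<delta>) powr (- \<beta>) = 1 / (8 * exp 1)"
      using \<delta> by (simp add: powr_divide powr_minus_divide \<delta>_powr[symmetric])
    ultimately have decay: "ratio (inverse z) \<le> 1 / (8 * exp 1) * ratio s"
      using s by simp
    have "ratio s / 4 \<le> U.moment 1 s"
    proof -
      have "(a + \<phi> s)\<^sup>2 \<le> (2 * \<phi> s)\<^sup>2" using pos a by (intro power_mono) auto
      then have "deriv \<phi> s / (2 * \<phi> s)\<^sup>2 \<le> deriv \<phi> s / (a + \<phi> s)\<^sup>2"
        using pos a deriv_exponent_nonneg[OF s(2)] by (intro divide_left_mono) auto
      then show ?thesis unfolding moment_1_potential[OF s(2)] by (simp add: power_mult_distrib mult.commute)
    qed
    then have "ennreal (ratio s / 4) \<le> ennreal (U.moment 1 s)" by (rule ennreal_leI)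
    also have "\<dots> \<le> ennreal (exp 1 * U.moment 1 (s / \<delta>)) + U.potential_density (\<delta> / s) * ennreal (1 / s\<^sup>2)"
      by (intro U.moment_1_le s \<delta>)
    also have "\<dots> \<le> ennreal (ratio s / 8) + U.potential_density z * ennreal (1 / s\<^sup>2)"
    proof -
      have "U.moment 1 (inverse z) \<le> ratio (inverse z)" using z by (intro moment_1_potential_le) auto
      also note decay
      finally have "exp 1 * U.moment 1 (inverse z) \<le> exp 1 * (1 / (8 * exp 1) * ratio s)"
        by (rule mult_left_mono) simp
      also have "\<dots> = ratio s / 8" by simp
      finally have "exp 1 * U.moment 1 (inverse z) \<le> ratio s / 8" .
      then show ?thesis unfolding s by (intro add_right_mono ennreal_leI)
    qed
    finally have *: "ennreal (ratio s / 4) \<le> ennreal (ratio s / 8) + U.potential_density z * ennreal (1 / s\<^sup>2)" .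
    have "ennreal (ratio s / 8) \<le> U.potential_density z * ennreal (1 / s\<^sup>2)"
    proof (cases "U.potential_density z * ennreal (1 / s\<^sup>2)")
      case (real w)
      with * ratio_nonneg have "ennreal (ratio s / 4) \<le> ennreal (ratio s / 8 + w)" by simp
      then have "ratio s / 8 \<le> w" using ratio_nonneg real by (subst (asm) ennreal_le_iff) auto
      then show ?thesis using real by (simp add: ennreal_leI)
    qed simp
    then have "ennreal (ratio s / 8) * ennreal (s\<^sup>2) \<le> U.potential_density z * ennreal (1 / s\<^sup>2) * ennreal (s\<^sup>2)"
      by (rule mult_right_mono) simp
    also have "\<dots> = U.potential_density z"
      using s by (simp add: mult.assoc ennreal_mult'[symmetric])
    finally have lower: "ennreal (ratio s / 8 * s\<^sup>2) \<le> U.potential_density z"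
      using ratio_nonneg by (subst ennreal_mult) simp_all
    \<comment> \<open>The decay estimate is used a second time, to return from rate \<open>s\<close>
      to the kernel at \<open>1 / z\<close>; the constant \<open>\<delta>\<^sup>2 / 8\<close> then
      comes from \<open>s\<^sup>2 = \<delta>\<^sup>2 / z\<^sup>2\<close>.\<close>
    have "ratio (inverse z) \<le> 1 * ratio s"
    proof (rule order_trans[OF decay mult_right_mono[OF _ ratio_nonneg]])
      show "1 / (8 * exp 1) \<le> (1 :: real)"
        using exp_ge_add_one_self[of "1 :: real"] by (simp add: field_simps)
    qed
    then have "\<delta>\<^sup>2 / 8 * (ratio (inverse z) / z\<^sup>2) \<le> \<delta>\<^sup>2 / 8 * (ratio s / z\<^sup>2)"
      by (intro mult_left_mono divide_right_mono) auto
    also have "\<dots> = ratio s / 8 * s\<^sup>2"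
      by (simp add: s_def power_divide mult_ac)
    finally have "ennreal (\<delta>\<^sup>2 / 8 * (ratio (inverse z) / z\<^sup>2)) \<le> ennreal (ratio s / 8 * s\<^sup>2)"
      by (rule ennreal_leI)
    with lower show "ennreal (\<delta>\<^sup>2 / 8 * (deriv \<phi> (inverse z) / (z\<^sup>2 * (\<phi> (inverse z))\<^sup>2))) \<le> U.potential_density z"
      by (simp add: mult_ac)
  qed (use \<delta> s1 in auto)
qed

lemma occupation_tendsto_0_iff:
  assumes q [measurable]: "q \<in> borel_measurable borel"
  shows "((\<lambda>t. SUP x. occupation t (\<lambda>y. ennreal \<bar>q y\<bar>) x) \<longlongrightarrow> 0) (at_right 0) \<longleftrightarrow>
    ((\<lambda>r. SUP x::real. \<integral>\<^sup>+z\<in>{0<..<r}.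
        ennreal (\<bar>q (z + x)\<bar> * (deriv \<phi> (inverse z) / (z\<^sup>2 * (\<phi> (inverse z))\<^sup>2))) \<partial>lborel)
      \<longlongrightarrow> 0) (at_right 0)"
    (is "(?H \<longlongrightarrow> 0) _ \<longleftrightarrow> (?K \<longlongrightarrow> 0) _")
proof -
  let ?k = "\<lambda>z. deriv \<phi> (inverse z) / (z\<^sup>2 * (\<phi> (inverse z))\<^sup>2)"
  let ?f = "\<lambda>y. ennreal \<bar>q y\<bar>"
  define V where "V r x = (\<integral>\<^sup>+z\<in>{..<r}. ?f (x + z) \<partial>potential a)" for r x
  have V_eq: "V r x = (\<integral>\<^sup>+z\<in>{0<..<r}. ?f (x + z) * U.potential_density z \<partial>lborel)" for r x
    unfolding V_def
    by (subst U.nn_integral_potential_density) (auto intro!: nn_integral_cong simp: mult_ac split: split_indicator)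
  have k_nonneg: "0 \<le> ?k z" if "0 < z" for z using deriv_exponent_nonneg[of "inverse z"] that by simp
  have upper: "(SUP x. V r x) \<le> ennreal (2 * exp 1) * ?K r" for r
  proof (intro SUP_least)
    fix x
    \<comment> \<open>The constant passes through the integral with the potential density, which is
      known to be measurable, and not through the one with the kernel, which contains
      \<open>deriv \<phi>\<close>. The same choice is made in \<open>lower\<close>.\<close>
    have "ennreal (1 / (2 * exp 1)) * V r x = (\<integral>\<^sup>+z. ennreal (1 / (2 * exp 1)) * (?f (x + z) * U.potential_density z * indicator {0<..<r} z) \<partial>lborel)"
      unfolding V_eq by (rule nn_integral_cmult[symmetric]) measurable
    also have "\<dots> \<le> (\<integral>\<^sup>+z\<in>{0<..<r}. ennreal (\<bar>q (z + x)\<bar> * ?k z) \<partial>lborel)"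
    proof (intro nn_integral_mono)
      fix z
      have "ennreal (1 / (2 * exp 1)) * (?f (x + z) * U.potential_density z) \<le> ennreal (\<bar>q (z + x)\<bar> * ?k z)" if "0 < z"
      proof -
        have "ennreal (1 / (2 * exp 1)) * (?f (x + z) * U.potential_density z)
            \<le> ennreal (1 / (2 * exp 1)) * (?f (x + z) * ennreal (2 * exp 1 * ?k z))"
          by (intro mult_left_mono potential_density_upper that) auto
        also have "\<dots> = ennreal (1 / (2 * exp 1) * (\<bar>q (x + z)\<bar> * (2 * exp 1 * ?k z)))"
          by (simp only: ennreal_mult'[symmetric] abs_ge_zero) (subst ennreal_mult'[symmetric], simp_all)
        also have "1 / (2 * exp 1) * (\<bar>q (x + z)\<bar> * (2 * exp 1 * ?k z)) = \<bar>q (z + x)\<bar> * ?k z"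
          by (simp add: add.commute)
        finally show ?thesis .
      qed
      then show "ennreal (1 / (2 * exp 1)) * (?f (x + z) * U.potential_density z * indicator {0<..<r} z)
        \<le> ennreal (\<bar>q (z + x)\<bar> * ?k z) * indicator {0<..<r} z"
        by (auto split: split_indicator)
    qed
    also have "\<dots> \<le> ?K r" by (rule SUP_upper) auto
    finally have "ennreal (2 * exp 1) * (ennreal (1 / (2 * exp 1)) * V r x) \<le> ennreal (2 * exp 1) * ?K r"
      by (rule mult_left_mono) auto
    then show "V r x \<le> ennreal (2 * exp 1) * ?K r"
      by (simp add: mult.assoc[symmetric] ennreal_mult'[symmetric])
  qed
  obtain c r0 where c: "0 < c" "0 < r0" "\<And>z. 0 < z \<Longrightarrow> z < r0 \<Longrightarrow> ennreal (c * ?k z) \<le> U.potential_density z"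
    using potential_density_lower by blast
  have lower: "?K r \<le> ennreal (1 / c) * (SUP x. V r x)" if r: "r \<le> r0" for r
  proof (intro SUP_least)
    fix x
    have "(\<integral>\<^sup>+z\<in>{0<..<r}. ennreal (\<bar>q (z + x)\<bar> * ?k z) \<partial>lborel)
      \<le> (\<integral>\<^sup>+z. ennreal (1 / c) * (?f (x + z) * U.potential_density z * indicator {0<..<r} z) \<partial>lborel)"
    proof (intro nn_integral_mono)
      fix z
      have "ennreal (\<bar>q (z + x)\<bar> * ?k z) \<le> ennreal (1 / c) * (?f (x + z) * U.potential_density z)" if z: "0 < z" "z < r"
      proof -
        have "\<bar>q (z + x)\<bar> * ?k z = 1 / c * (\<bar>q (x + z)\<bar> * (c * ?k z))"
          using c by (simp add: add.commute)
        then have "ennreal (\<bar>q (z + x)\<bar> * ?k z) = ennreal (1 / c) * (?f (x + z) * ennreal (c * ?k z))"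
          using c by (simp only:) (subst ennreal_mult', simp, subst ennreal_mult', simp_all)
        also have "\<dots> \<le> ennreal (1 / c) * (?f (x + z) * U.potential_density z)"
          using z r by (intro mult_left_mono c) auto
        finally show ?thesis .
      qed
      then show "ennreal (\<bar>q (z + x)\<bar> * ?k z) * indicator {0<..<r} z
        \<le> ennreal (1 / c) * (?f (x + z) * U.potential_density z * indicator {0<..<r} z)"
        by (auto split: split_indicator)
    qed
    also have "\<dots> = ennreal (1 / c) * V r x"
      unfolding V_eq by (rule nn_integral_cmult) measurable
    also have "\<dots> \<le> ennreal (1 / c) * (SUP x. V r x)" by (intro mult_left_mono SUP_upper) auto
    finally show "(\<integral>\<^sup>+z\<in>{0<..<r}. ennreal (\<bar>q (z + x)\<bar> * ?k z) \<partial>lborel) \<le> ennreal (1 / c) * (SUP x. V r x)" .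
  qed
  show ?thesis
  proof
    assume H: "(?H \<longlongrightarrow> 0) (at_right 0)"
    show "(?K \<longlongrightarrow> 0) (at_right 0)"
    proof (rule ennreal_tendsto_0I)
      fix e :: real assume e: "0 < e"
      \<comment> \<open>Undoes the factor \<open>1 / c\<close> of the density bound and the factor
        \<open>2 * exp 1\<close> of the block argument.\<close>
      define e' where "e' = e * c / (2 * exp 1)"
      have e': "0 < e'" using e c by (simp add: e'_def)
      have "eventually (\<lambda>t. ?H t \<le> ennreal e' \<and> 0 < t) (at_right 0)"
        using ennreal_tendsto_0D[OF H e'] eventually_at_right_less by (rule eventually_conj)
      then obtain t where t: "?H t \<le> ennreal e'" "0 < t"
        using eventually_happens'[OF trivial_limit_at_right_real] by blast
      \<comment> \<open>With \<open>t\<close> fixed, small \<open>r\<close> gives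
        \<open>t * \<phi> (1 / r) \<ge> ln 2\<close>, the decay by one half per block.\<close>
      have "filterlim (\<lambda>r. \<phi> (inverse r)) at_top (at_right 0)"
        by (rule filterlim_compose[OF exponent_at_top[OF unbounded] filterlim_inverse_at_top_right])
      then have "eventually (\<lambda>r. ln 2 / t \<le> \<phi> (inverse r)) (at_right 0)" by (simp add: filterlim_at_top)
      moreover have "eventually (\<lambda>r. r < r0) (at_right 0)"
        using c by (intro eventually_at_rightI[of 0 r0]) auto
      moreover have "eventually (\<lambda>r::real. 0 < r) (at_right 0)" by (rule eventually_at_right_less)
      ultimately show "eventually (\<lambda>r. ?K r \<le> ennreal e) (at_right 0)"
      proof eventually_elim
        case (elim r)
        have "ln 2 \<le> t * \<phi> (inverse r)" using elim t by (simp add: field_simps)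
        then have "exp (- t * \<phi> (inverse r)) \<le> exp (- ln 2)" by simp
        then have small: "exp (- t * \<phi> (inverse r)) \<le> 1 / 2" by (simp add: exp_minus)
        have "?K r \<le> ennreal (1 / c) * (SUP x. V r x)" using elim by (intro lower) auto
        also have "\<dots> \<le> ennreal (1 / c) * (ennreal (2 * exp 1) * ?H t)"
          unfolding V_def using small elim t a
          by (intro mult_left_mono SUP_least potential_le_occupation) auto
        also have "\<dots> \<le> ennreal (1 / c) * (ennreal (2 * exp 1) * ennreal e')"
          by (intro mult_left_mono t) auto
        also have "\<dots> = ennreal e"
          using c e by (simp add: e'_def ennreal_mult'[symmetric])
        finally show ?case .
      qed
    qed
  next
    assume K: "(?K \<longlongrightarrow> 0) (at_right 0)"
    show "(?H \<longlongrightarrow> 0) (at_right 0)"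
    proof (rule ennreal_tendsto_0I)
      fix e :: real assume e: "0 < e"
      \<comment> \<open>The factor 2 comes from absorbing \<open>H / 2\<close>, \<open>exp a\<close>
        bounds \<open>exp (a * t)\<close> for \<open>t < 1\<close>, and \<open>2 * exp 1\<close> is
        the constant in \<open>upper\<close>.\<close>
      define e' where "e' = e / (2 * exp a * (2 * exp 1))"
      have e': "0 < e'" using e by (simp add: e'_def)
      have "eventually (\<lambda>r. ?K r \<le> ennreal e' \<and> 0 < r) (at_right 0)"
        using ennreal_tendsto_0D[OF K e'] eventually_at_right_less by (rule eventually_conj)
      then obtain r where r: "?K r \<le> ennreal e'" "0 < r"
        using eventually_happens'[OF trivial_limit_at_right_real] by blast
      \<comment> \<open>With \<open>r\<close> fixed, small \<open>t\<close> makes passing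
        \<open>r\<close> before time \<open>t\<close> have probability at most \<open>1 / 2\<close>;
        the threshold \<open>(1 - exp (-1)) / 2\<close> accounts for the constant in
        \<open>emeasure_ge_le\<close>.\<close>
      have "((\<lambda>t. 1 - exp (- t * \<phi> (inverse r))) \<longlongrightarrow> 1 - exp (- 0 * \<phi> (inverse r))) (at_right 0)"
        by (intro tendsto_intros)
      then have "eventually (\<lambda>t. 1 - exp (- t * \<phi> (inverse r)) < (1 - exp (-1)) / 2) (at_right 0)"
        by (rule order_tendstoD) simp
      moreover have "eventually (\<lambda>t::real. t < 1) (at_right 0)"
        by (intro eventually_at_rightI[of 0 1]) auto
      moreover have "eventually (\<lambda>t::real. 0 < t) (at_right 0)" by (rule eventually_at_right_less)
      ultimately show "eventually (\<lambda>t. ?H t \<le> ennreal e) (at_right 0)"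
      proof eventually_elim
        case (elim t)
        define p where "p = prob {\<omega> \<in> space M. r \<le> Y t \<omega>}"
        have "ennreal (1 - exp (-1)) * ennreal p \<le> ennreal (1 - exp (- t * \<phi> (inverse r)))"
          using emeasure_ge_le[of t r] elim r by (simp add: p_def emeasure_eq_measure)
        also have "\<dots> \<le> ennreal ((1 - exp (-1)) / 2)" using elim by (intro ennreal_leI) auto
        finally have "ennreal ((1 - exp (-1)) * p) \<le> ennreal ((1 - exp (-1)) / 2)"
          by (simp add: ennreal_mult' p_def)
        then have "(1 - exp (-1)) * p \<le> (1 - exp (-1)) * (1 / 2)"
          by (subst (asm) ennreal_le_iff) auto
        then have "p \<le> 1 / 2" by (rule mult_left_le_imp_le) simp
        then have half: "emeasure M {\<omega> \<in> space M. r \<le> Y t \<omega>} \<le> ennreal (1 / 2)"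
          unfolding emeasure_eq_measure p_def by (rule ennreal_leI)
        have "?H t \<le> 2 * (ennreal (exp (a * t)) * (SUP x. V r x))"
          unfolding V_def using elim r a half by (intro occupation_le_potential) auto
        also have "\<dots> \<le> 2 * (ennreal (exp a) * (ennreal (2 * exp 1) * ennreal e'))"
          using elim a mult_left_mono[of t 1 a]
          by (intro mult_left_mono mult_mono order_trans[OF upper] ennreal_leI r) auto
        also have "\<dots> = ennreal (2 * (exp a * (2 * exp 1 * e')))"
          using e' by (simp add: ennreal_mult mult_ac)
        also have "2 * (exp a * (2 * exp 1 * e')) = e" by (simp add: e'_def)
        finally show ?case .
      qed
    qed
  qed
qed

end

end

theorem proposition5p6:
  fixes M :: "'w measure" and X :: "real \<Rightarrow> 'w \<Rightarrow> real" and \<phi> q :: "real \<Rightarrow> real"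
  assumes "subordinator M X"
    and "laplace_exponent M X \<phi>"
    and S1: "\<not> bounded (\<phi> ` {0..})" "has_drift \<phi> 0"
    and S2: "\<exists>a\<ge>0. special_bernstein (\<lambda>u. a + \<phi> u)"
    and S3: "\<exists>\<beta>>0. \<exists>\<theta>'\<ge>0. \<exists>C\<ge>1. \<forall>\<eta>\<ge>1. \<forall>\<theta>>\<theta>'.
      deriv \<phi> (\<eta> * \<theta>) / (\<phi> (\<eta> * \<theta>))\<^sup>2 \<le> C * \<eta> powr (- \<beta>) * (deriv \<phi> \<theta> / (\<phi> \<theta>)\<^sup>2)"
    and "q \<in> borel_measurable borel"
  shows "q \<in> kato_class M X \<longleftrightarrow>
    ((\<lambda>r. SUP x::real. \<integral>\<^sup>+z\<in>{0<..<r}.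
        ennreal (\<bar>q (z + x)\<bar> * (deriv \<phi> (inverse z) / (z\<^sup>2 * (\<phi> (inverse z))\<^sup>2))) \<partial>lborel)
      \<longlongrightarrow> 0) (at_right 0)"
proof -
  interpret subordinator M X by fact
  obtain Y where Y: "regular_subordinator M Y \<phi>" "AE \<omega> in M. \<forall>t\<ge>0. Y t \<omega> = X t \<omega>"
    using regular_modification[OF assms(2)] by blast
  interpret Y: regular_subordinator M Y \<phi> by fact
  obtain a where a: "0 \<le> a" "special_bernstein (\<lambda>u. a + \<phi> u)" using S2 by blast
  obtain \<beta> \<theta>' C where scaling: "0 < \<beta>" "0 \<le> \<theta>'" "1 \<le> C"
      "\<And>\<eta> \<theta>. 1 \<le> \<eta> \<Longrightarrow> \<theta>' < \<theta> \<Longrightarrow>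
        deriv \<phi> (\<eta> * \<theta>) / (\<phi> (\<eta> * \<theta>))\<^sup>2 \<le> C * \<eta> powr (- \<beta>) * (deriv \<phi> \<theta> / (\<phi> \<theta>)\<^sup>2)"
    using S3 by blast
  \<comment> \<open>One null set serves all times at once, so the time integrals agree along almost
    every path.\<close>
  have "(\<integral>\<^sup>+\<omega>. (\<integral>\<^sup>+u\<in>{0..t}. ennreal \<bar>q (x + X u \<omega>)\<bar> \<partial>lborel) \<partial>M)
      = Y.occupation t (\<lambda>y. ennreal \<bar>q y\<bar>) x" for t x
    unfolding Y.occupation_def using Y(2)
    by (intro nn_integral_cong_AE) (auto elim!: eventually_mono intro!: nn_integral_cong split: split_indicator)
  then have "q \<in> kato_class M X \<longleftrightarrow>
      ((\<lambda>t. SUP x. Y.occupation t (\<lambda>y. ennreal \<bar>q y\<bar>) x) \<longlongrightarrow> 0) (at_right 0)"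
    by (simp add: kato_class_def)
  also note Y.occupation_tendsto_0_iff[OF S1(1) a scaling assms(7)]
  finally show ?thesis .
qed

end
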